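(* Let $m>2$ be a real number, let $a,b\in\mathbb{C}$ with $a\neq 0$, and consider the two-degrees-of-freedom Hamiltonian system with Hamiltonian $$H(q_1,q_2,p_1,p_2)=\frac{p_1^2+p_2^2}{2}-\frac{1}{a q_1^m+b q_2^m}.$$ Let $\gamma(t)=(q_1(t),0,p_1(t),0)$ be an integral curve of this system contained in the invariant plane $\{q_2=p_2=0\}$ and lying on the energy level $H=h=0$. Then the differential Galois group over $\mathbb{C}(t)$ of the first variational equation of the system along $\gamma$ is virtually abelian. Furthermore, for fixed $m$, this Galois group is independent of the choice of $a$ and $b$ (with $a\neq 0$): for any two choices of $(a,b)$ the corresponding Galois groups, viewed as algebraic subgroups of $GL(4,\mathbb{C})$ via a fundamental matrix of solutions, coincide up to conjugation.
   Context: For a Hamiltonian $H(q_1,q_2,p_1,p_2)$, the Hamilton equations are $\dot q_i=\partial H/\partial p_i$, $\dot p_i=-\partial H/\partial q_i$, $i=1,2$, where the dot is the derivative with respect to (complex) time $t$. The first variational equation along an integral curve $\gamma(t)$ is the linear system $\dot\xi=A(t)\xi$, $\xi=(\xi_1,\xi_2,\xi_3,\xi_4)^T$, obtained by linearizing the Hamilton equations along $\gamma$; in $2\times 2$ blocks, $$A(t)=\begin{pmatrix} H_{pq} & H_{pp}\\ -H_{qq} & -H_{qp}\end{pmatrix}\Big|_{\gamma(t)},$$ where $(H_{pq})_{ij}=\partial^2H/\partial p_i\partial q_j$, $(H_{pp})_{ij}=\partial^2H/\partial p_i\partial p_j$, $(H_{qq})_{ij}=\partial^2H/\partial q_i\partial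 q_j$, $(H_{qp})_{ij}=\partial^2H/\partial q_i\partial p_j$. Here $\gamma$ is any local analytic solution. When $m$ is not an integer, $q_1^m$ denotes a locally chosen analytic branch along the curve, and the derivatives of $q_2^m$ of order at most $2$ at $q_2=0$ are understood as their limits as $q_2\to 0$ (which are $0$, since $m>2$). Along such a $\gamma$ the entries of $A(t)$ are rational functions of $t$. The differential Galois group of a linear system $\dot\xi=A(t)\xi$ with $A$ having entries in $\mathbb{C}(t)$ is the group of differential automorphisms of a Picard-Vessiot extension $L$ of $\mathbb{C}(t)$ for the system that fix $\mathbb{C}(t)$ pointwise; through its action on a fundamental matrix of solutions it is an algebraic subgroup of $GL(4,\mathbb{C})$, well defined up to conjugation. It is called virtually abelian if the connected component of its identity element is abelian. *)

theory Defs
  imports "HOL-Complex_Analysis.Complex_Analysis"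
    "HOL-Computational_Algebra.Computational_Algebra"
begin

section \<open>The Hamiltonian system\<close>

text \<open>Phase space is \<open>complex^4\<close> with coordinates \<open>(q\<^sub>1, q\<^sub>2, p\<^sub>1, p\<^sub>2)\<close> at the indices 1, 2, 3, 4.\<close>

definition partial_deriv :: "4 \<Rightarrow> (complex^4 \<Rightarrow> complex) \<Rightarrow> complex^4 \<Rightarrow> complex" where
  "partial_deriv i f z = deriv (\<lambda>s. f (z + axis i s)) 0"

definition hamiltonian_field :: "(complex^4 \<Rightarrow> complex) \<Rightarrow> complex^4 \<Rightarrow> complex^4" where
  "hamiltonian_field H z = vector
    [partial_deriv 3 H z, partial_deriv 4 H z, - partial_deriv 1 H z, - partial_deriv 2 H z]"

definition jacobian :: "(complex^4 \<Rightarrow> complex^4) \<Rightarrow> complex^4 \<Rightarrow> complex^4^4" where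
  "jacobian X z = (\<chi> i j. partial_deriv j (\<lambda>y. X y $ i) z)"

text \<open>The analytic branch of \<open>z\<^sup>m\<close> near \<open>exp w\<close> that is determined by the value \<open>w\<close> of the
  logarithm, i.e. that takes the value \<open>exp (m w)\<close> at \<open>exp w\<close>. It does not depend on the choice of
  \<open>w\<close> when \<open>m\<close> is an integer.\<close>

definition power_branch :: "real \<Rightarrow> complex \<Rightarrow> complex \<Rightarrow> complex" where
  "power_branch m w z = exp (of_real m * (w + Ln (z / exp w)))"

text \<open>The Hamiltonian near a point with \<open>q\<^sub>1 = exp w\<^sub>1\<close> and \<open>q\<^sub>2 = exp w\<^sub>2\<close>.\<close>

definition ham :: "real \<Rightarrow> complex \<Rightarrow> complex \<Rightarrow> complex \<Rightarrow> complex \<Rightarrow> complex^4 \<Rightarrow> complex" where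
  "ham m a b w\<^sub>1 w\<^sub>2 z = ((z$3)\<^sup>2 + (z$4)\<^sup>2) / 2
     - 1 / (a * power_branch m w\<^sub>1 (z$1) + b * power_branch m w\<^sub>2 (z$2))"

text \<open>Quantities that involve derivatives of \<open>q\<^sub>2\<^sup>m\<close> at \<open>q\<^sub>2 = 0\<close> are limits as \<open>q\<^sub>2 = exp w\<close> tends
  to 0. The limit is taken over all logarithms \<open>w\<close>, hence uniformly over all branches of \<open>q\<^sub>2\<^sup>m\<close>.\<close>

abbreviation q2_to_0 :: "complex filter" where
  "q2_to_0 \<equiv> filtercomap exp (at 0)"

text \<open>A local analytic solution \<open>\<gamma>\<close> in the plane \<open>q\<^sub>2 = p\<^sub>2 = 0\<close> on the energy level 0. The function
  \<open>lg\<close> is a logarithm of \<open>q\<^sub>1\<close> along \<open>\<gamma>\<close>; it fixes the branch of \<open>q\<^sub>1\<^sup>m\<close>.\<close>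

definition zero_energy_curve ::
  "real \<Rightarrow> complex \<Rightarrow> complex \<Rightarrow> complex set \<Rightarrow> (complex \<Rightarrow> complex^4) \<Rightarrow> (complex \<Rightarrow> complex) \<Rightarrow> bool"
  where
  "zero_energy_curve m a b U \<gamma> lg \<longleftrightarrow>
     open U \<and> connected U \<and> U \<noteq> {} \<and>
     lg holomorphic_on U \<and>
     (\<forall>t\<in>U. exp (lg t) = \<gamma> t $ 1 \<and> \<gamma> t $ 2 = 0 \<and> \<gamma> t $ 4 = 0) \<and>
     (\<forall>t\<in>U. \<exists>v. (\<forall>i. ((\<lambda>s. \<gamma> s $ i) has_field_derivative v $ i) (at t)) \<and>
        ((\<lambda>w. hamiltonian_field (ham m a b (lg t) w) (\<gamma> t + axis 2 (exp w))) \<longlongrightarrow> v) q2_to_0) \<and>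
     (\<forall>t\<in>U. ((\<lambda>w. ham m a b (lg t) w (\<gamma> t + axis 2 (exp w))) \<longlongrightarrow> 0) q2_to_0)"


section \<open>The first variational equation over \<open>\<complex>(t)\<close>\<close>

type_synonym ratfun = "complex poly fract"

definition ratfun_value :: "ratfun \<Rightarrow> complex \<Rightarrow> complex \<Rightarrow> bool" where
  "ratfun_value f t v \<longleftrightarrow> (\<exists>p q. f = Fract p q \<and> poly q t \<noteq> 0 \<and> v = poly p t / poly q t)"

text \<open>\<open>A\<close> is the coefficient matrix of the first variational equation along \<open>\<gamma>\<close>, as a matrix of
  rational functions of \<open>t\<close>.\<close>

definition variational_matrix ::
  "real \<Rightarrow> complex \<Rightarrow> complex \<Rightarrow> complex set \<Rightarrow> (complex \<Rightarrow> complex^4) \<Rightarrow> (complex \<Rightarrow> complex)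
     \<Rightarrow> ratfun^4^4 \<Rightarrow> bool" where
  "variational_matrix m a b U \<gamma> lg A \<longleftrightarrow>
     (\<forall>t\<in>U. \<exists>M. ((\<lambda>w. jacobian (hamiltonian_field (ham m a b (lg t) w)) (\<gamma> t + axis 2 (exp w)))
                    \<longlongrightarrow> M) q2_to_0 \<and>
               (\<forall>i j. ratfun_value (A $ i $ j) t (M $ i $ j)))"


section \<open>Differential Galois groups over \<open>\<complex>(t)\<close>\<close>

definition ratfun_deriv :: "ratfun \<Rightarrow> ratfun" where
  "ratfun_deriv f = (THE g. \<exists>p q. q \<noteq> 0 \<and> f = Fract p q \<and>
     g = Fract (pderiv p * q - p * pderiv q) (q * q))"

lemma ratfun_deriv_Fract:
  assumes "q \<noteq> 0"
  shows "ratfun_deriv (Fract p q) = Fract (pderiv p * q - p * pderiv q) (q * q)"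
  unfolding ratfun_deriv_def
proof (rule the_equality)
  fix g
  assume "\<exists>r s. s \<noteq> 0 \<and> Fract p q = Fract r s \<and> g = Fract (pderiv r * s - r * pderiv s) (s * s)"
  then obtain r s where s: "s \<noteq> 0" "Fract p q = Fract r s"
    and g: "g = Fract (pderiv r * s - r * pderiv s) (s * s)" by blast
  have eq: "p * s = r * q" using s assms by (simp add: eq_fract)
  have "pderiv p * s + p * pderiv s = pderiv r * q + r * pderiv q"
    using arg_cong[OF eq, of pderiv] by (simp add: pderiv_mult algebra_simps)
  with eq have "(pderiv r * s - r * pderiv s) * (q * q) = (pderiv p * q - p * pderiv q) * (s * s)"
    by algebra
  then show "g = Fract (pderiv p * q - p * pderiv q) (q * q)"
    using s assms by (simp add: g eq_fract)
qed (use assms in blast)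

definition field_hom :: "('a::field \<Rightarrow> 'b::field) \<Rightarrow> bool" where
  "field_hom f \<longleftrightarrow> f 1 = 1 \<and> (\<forall>x y. f (x + y) = f x + f y) \<and> (\<forall>x y. f (x * y) = f x * f y)"

definition derivation :: "('a::field \<Rightarrow> 'a) \<Rightarrow> bool" where
  "derivation D \<longleftrightarrow> (\<forall>x y. D (x + y) = D x + D y) \<and> (\<forall>x y. D (x * y) = D x * y + x * D y)"

definition is_subfield :: "'a::field set \<Rightarrow> bool" where
  "is_subfield K \<longleftrightarrow> 1 \<in> K \<and> (\<forall>x\<in>K. \<forall>y\<in>K. x - y \<in> K \<and> x * y \<in> K) \<and> (\<forall>x\<in>K. inverse x \<in> K)"

text \<open>An extension of the differential field \<open>\<complex>(t)\<close> is a field type \<open>'l\<close> with a derivation \<open>D\<close> and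
  an embedding \<open>\<iota>\<close> of differential fields.\<close>

definition diff_extension :: "(ratfun \<Rightarrow> 'l::field) \<Rightarrow> ('l \<Rightarrow> 'l) \<Rightarrow> bool" where
  "diff_extension \<iota> D \<longleftrightarrow> field_hom \<iota> \<and> derivation D \<and> (\<forall>f. D (\<iota> f) = \<iota> (ratfun_deriv f))"

abbreviation const_emb :: "(ratfun \<Rightarrow> 'l::field) \<Rightarrow> complex \<Rightarrow> 'l" where
  "const_emb \<iota> c \<equiv> \<iota> (to_fract [:c:])"

definition fundamental_matrix ::
  "(ratfun \<Rightarrow> 'l::field) \<Rightarrow> ('l \<Rightarrow> 'l) \<Rightarrow> ratfun^'n^'n \<Rightarrow> 'l^'n^'n \<Rightarrow> bool" where
  "fundamental_matrix \<iota> D A F \<longleftrightarrow> invertible F \<and> map_matrix D F = map_matrix \<iota> A ** F"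

definition picard_vessiot ::
  "(ratfun \<Rightarrow> 'l::field) \<Rightarrow> ('l \<Rightarrow> 'l) \<Rightarrow> ratfun^'n^'n \<Rightarrow> bool" where
  "picard_vessiot \<iota> D A \<longleftrightarrow>
     diff_extension \<iota> D \<and>
     {x. D x = 0} = range (const_emb \<iota>) \<and>
     (\<exists>F. fundamental_matrix \<iota> D A F \<and>
       (\<forall>K. is_subfield K \<and> range \<iota> \<subseteq> K \<and> (\<forall>i j. F $ i $ j \<in> K) \<longrightarrow> K = UNIV))"

definition diff_automorphisms :: "(ratfun \<Rightarrow> 'l::field) \<Rightarrow> ('l \<Rightarrow> 'l) \<Rightarrow> ('l \<Rightarrow> 'l) set" where
  "diff_automorphisms \<iota> D =
     {\<sigma>. field_hom \<sigma> \<and> bij \<sigma> \<and> (\<forall>x. \<sigma> (D x) = D (\<sigma> x)) \<and> (\<forall>f. \<sigma> (\<iota> f) = \<iota> f)}"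

definition galois_matrices ::
  "(ratfun \<Rightarrow> 'l::field) \<Rightarrow> ('l \<Rightarrow> 'l) \<Rightarrow> 'l^'n^'n \<Rightarrow> (complex^'n^'n) set" where
  "galois_matrices \<iota> D F =
     {M. \<exists>\<sigma>\<in>diff_automorphisms \<iota> D. map_matrix \<sigma> F = F ** map_matrix (const_emb \<iota>) M}"

text \<open>\<open>G\<close> is the differential Galois group of \<open>\<xi>' = A \<xi>\<close>, as a group of matrices, with respect to
  the Picard-Vessiot extension \<open>(\<iota>, D)\<close> and some fundamental matrix in it.\<close>

definition diff_galois_group ::
  "(ratfun \<Rightarrow> 'l::field) \<Rightarrow> ('l \<Rightarrow> 'l) \<Rightarrow> ratfun^'n^'n \<Rightarrow> (complex^'n^'n) set \<Rightarrow> bool" where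
  "diff_galois_group \<iota> D A G \<longleftrightarrow>
     picard_vessiot \<iota> D A \<and> (\<exists>F. fundamental_matrix \<iota> D A F \<and> G = galois_matrices \<iota> D F)"


section \<open>Virtually abelian linear algebraic groups\<close>

inductive_set matrix_polys :: "(complex^'n^'n \<Rightarrow> complex) set" where
  const: "(\<lambda>M. c) \<in> matrix_polys"
| entry: "(\<lambda>M. M $ i $ j) \<in> matrix_polys"
| add: "f \<in> matrix_polys \<Longrightarrow> g \<in> matrix_polys \<Longrightarrow> (\<lambda>M. f M + g M) \<in> matrix_polys"
| mult: "f \<in> matrix_polys \<Longrightarrow> g \<in> matrix_polys \<Longrightarrow> (\<lambda>M. f M * g M) \<in> matrix_polys"

definition zariski :: "(complex^'n^'n) topology" where
  "zariski = topology_generated_by ((\<lambda>f. {M. f M \<noteq> 0}) ` matrix_polys)"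

definition identity_component :: "(complex^'n^'n) set \<Rightarrow> (complex^'n^'n) set" where
  "identity_component G = connected_component_of_set (subtopology zariski G) (mat 1)"

definition virtually_abelian :: "(complex^'n^'n) set \<Rightarrow> bool" where
  "virtually_abelian G \<longleftrightarrow>
     (\<forall>M\<in>identity_component G. \<forall>N\<in>identity_component G. M ** N = N ** M)"

definition conjugate_in_GL :: "(complex^'n^'n) set \<Rightarrow> (complex^'n^'n) set \<Rightarrow> bool" where
  "conjugate_in_GL G G' \<longleftrightarrow> (\<exists>P. invertible P \<and> G' = (\<lambda>M. P ** M ** matrix_inv P) ` G)"

end

theory Submission
  imports Defs
begin

text \<open>On energy level 0 the quotient \<open>q\<^sub>1 / p\<^sub>1\<close> has derivative \<open>(m + 2) / 2\<close>, so along the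
  curve the variational equation splits into \<open>\<xi>\<^sub>2'' = 0\<close> (as \<open>m > 2\<close>) and the Euler equation
  \<open>\<xi>\<^sub>1'' = r (r - 1) \<xi>\<^sub>1 / (t - t\<^sub>0)\<^sup>2\<close> with \<open>r = 2 (m + 1) / (m + 2)\<close>, whatever \<open>a\<close> and \<open>b\<close>
  are. Its solutions are spanned by \<open>y\<close> and \<open>(t - t\<^sub>0) / y\<close>, where \<open>y\<close> stands for
  \<open>(t - t\<^sub>0)\<^sup>r\<close>. Hence the Picard-Vessiot field is \<open>\<complex>(t, y)\<close>, and its automorphisms are the
  scalings \<open>y \<mapsto> c y\<close> by those \<open>c \<noteq> 0\<close> with \<open>c\<^sup>n = 1\<close> whenever \<open>n r\<close> is an integer. The Galois
  group is therefore conjugate to a group of diagonal matrices that depends on \<open>m\<close> only.\<close>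

unbundle no Formal_Power_Series.fps_syntax

section \<open>Differential field extensions of the rational functions\<close>

text \<open>The Picard-Vessiot extension is an arbitrary differential field, so no element called (t
  - t0)^r is given in it. It is produced by factoring the Euler operator: with T = t - t0, d^2 - r
  (r - 1) / T^2 = (d + (1 - r) / T) (d - (1 - r) / T), so w = xi' - (1 - r) xi / T satisfies w' = (r
  - 1) w / T, and y = T w. The main obstacle is to have enough automorphisms. Depending on r, y is
  algebraic or transcendental over C(t); both cases are treated at once by showing that the
  substitution of c y for y preserves every polynomial relation of y. This rests on the fact that T
  f' = s f has a nonzero rational solution f only for integers s. The two exponents r and 1 - r must
  differ, since otherwise a logarithm would appear; here r = 2 - 2 / (m + 2) > 3/2. The energy level
  matters because p1^2 / 2 = 1 / (a q1^m) eliminates the power of q1 together with a, while b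
  disappears in the limit q2 = 0. The limit group is commutative as a whole, so its identity
  component never has to be computed.\<close>

lemma mult_pderiv_power_mult:
  fixes X :: "'a::idom poly"
  assumes "pderiv X = 1"
  shows "X * pderiv (X ^ n * s) = X ^ n * (of_nat n * s + X * pderiv s)"
proof -
  \<comment> \<open>The factor X keeps the exponent n - 1 out of the formula, so that n = 0 is no
    special case.\<close>
  have "X * pderiv (X ^ n) = of_nat n * X ^ n"
  proof (induction n)
    case (Suc n)
    have "X * pderiv (X ^ Suc n) = X * (X * pderiv (X ^ n)) + X * X ^ n"
      by (simp only: power_Suc pderiv_mult assms distrib_left mult_1_right)
    then show ?case by (simp only: Suc) (simp add: distrib_right distrib_left mult.left_commute)
  qed simp
  moreover have "X * pderiv (X ^ n * s) = X ^ n * (X * pderiv s) + s * (X * pderiv (X ^ n))"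
    by (simp only: pderiv_mult distrib_left mult.left_commute)
  ultimately show ?thesis
    by (simp only: distrib_left mult.left_commute mult.commute add.commute)
qed

text \<open>The equation says f' / f = r / (t - t0), and the residue of a logarithmic derivative at
  t0 is the order of f there. With f = p / q this order is the difference of the orders of p and q
  at t0, whether or not p and q are coprime.\<close>

lemma ratfun_log_deriv_Ints:
  assumes f: "f \<noteq> 0"
    and eq: "to_fract [:-t0, 1:] * ratfun_deriv f = to_fract [:r:] * f"
  shows "r \<in> \<int>"
proof -
  obtain p q where pq: "f = Fract p q" "q \<noteq> 0" by (cases f) auto
  have p: "p \<noteq> 0" using f pq by (auto simp: Zero_fract_def eq_fract)
  have "Fract ([:-t0, 1:] * (pderiv p * q - p * pderiv q)) (q * q) = Fract ([:r:] * p) q"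
    using eq pq by (simp add: ratfun_deriv_Fract to_fract_def)
  then have "[:-t0, 1:] * (pderiv p * q - p * pderiv q) * q = [:r:] * p * (q * q)"
    using pq by (simp add: eq_fract del: mult_pCons_left mult_pCons_right)
  then have main: "[:-t0, 1:] * (pderiv p * q - p * pderiv q) = [:r:] * p * q"
    using pq(2) by (metis mult.assoc mult_right_cancel)
  define \<alpha> \<beta> where "\<alpha> = order t0 p" and "\<beta> = order t0 q"
  obtain p1 where p1: "p = [:-t0, 1:] ^ \<alpha> * p1" "\<not> [:-t0, 1:] dvd p1"
    using order_decomp[OF p] unfolding \<alpha>_def by blast
  obtain q1 where q1: "q = [:-t0, 1:] ^ \<beta> * q1" "\<not> [:-t0, 1:] dvd q1"
    using order_decomp[OF pq(2)] unfolding \<beta>_def by blast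
  have d: "[:-t0, 1:] * pderiv ([:-t0, 1:] ^ n * s)
      = [:-t0, 1:] ^ n * (of_nat n * s + [:-t0, 1:] * pderiv s)" for n s
    by (rule mult_pderiv_power_mult) (simp add: pderiv_pCons)
  have "[:-t0, 1:] * pderiv p * q - p * ([:-t0, 1:] * pderiv q) = [:r:] * p * q"
    using main by (simp add: algebra_simps del: mult_pCons_left mult_pCons_right)
  moreover define u v where "u = of_nat \<alpha> * p1 + [:-t0, 1:] * pderiv p1"
    and "v = of_nat \<beta> * q1 + [:-t0, 1:] * pderiv q1"
  ultimately have eq': "[:-t0, 1:] ^ \<alpha> * u * q - p * ([:-t0, 1:] ^ \<beta> * v) = [:r:] * p * q"
    using d[of \<alpha> p1] d[of \<beta> q1] p1(1) q1(1) by metis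
  have "[:-t0, 1:] ^ (\<alpha> + \<beta>) * (u * q1 - p1 * v)
      = [:-t0, 1:] ^ \<alpha> * u * q - p * ([:-t0, 1:] ^ \<beta> * v)"
    unfolding p1(1) q1(1) power_add
    by (simp only: right_diff_distrib left_diff_distrib mult.assoc mult.left_commute mult.commute)
  also have "\<dots> = [:-t0, 1:] ^ (\<alpha> + \<beta>) * ([:r:] * p1 * q1)"
    unfolding eq' unfolding p1(1) q1(1) power_add
    by (simp only: mult.assoc mult.left_commute mult.commute)
  finally have "u * q1 - p1 * v = [:r:] * p1 * q1"
    by (subst (asm) mult_left_cancel) auto
  \<comment> \<open>Once the common power of t - t0 is cancelled, evaluation at t0 kills the
    derivative terms in \<open>u\<close> and \<open>v\<close> and leaves only the
    multiplicities.\<close>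
  from arg_cong[OF this, of "\<lambda>s. poly s t0"]
  have "(of_nat \<alpha> - of_nat \<beta>) * (poly p1 t0 * poly q1 t0) = r * (poly p1 t0 * poly q1 t0)"
    by (simp add: u_def v_def algebra_simps)
  moreover have "poly p1 t0 \<noteq> 0" "poly q1 t0 \<noteq> 0"
    using p1(2) q1(2) by (simp_all add: poly_eq_0_iff_dvd)
  ultimately have "r = of_int (int \<alpha> - int \<beta>)" by simp
  then show ?thesis by (metis Ints_of_int)
qed

lemma matrix_inv_mult_self:
  assumes "invertible (F :: 'a::semiring_1^'n^'n)"
  shows "F ** matrix_inv F = mat 1" "matrix_inv F ** F = mat 1"
  using someI_ex[OF assms[unfolded invertible_def]] by (simp_all add: matrix_inv_def)

section \<open>Homomorphisms and derivations of fields\<close>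

locale field_homomorphism =
  fixes h :: "'a::field \<Rightarrow> 'b::field"
  assumes hom: "field_hom h"
begin

lemma hom_1 [simp]: "h 1 = 1"
  and hom_add [simp]: "h (x + y) = h x + h y"
  and hom_mult [simp]: "h (x * y) = h x * h y"
  using hom by (auto simp: field_hom_def)

lemma hom_0 [simp]: "h 0 = 0"
  by (metis hom_add add.right_neutral add_left_cancel)

lemma hom_uminus [simp]: "h (- x) = - h x"
  using hom_add[of x "- x"] by (simp add: eq_neg_iff_add_eq_0 add.commute)

lemma hom_diff [simp]: "h (x - y) = h x - h y"
  using hom_add[of x "- y"] by simp

lemma hom_eq_0_iff [simp]: "h x = 0 \<longleftrightarrow> x = 0"
  using hom_mult[of x "inverse x"] by (cases "x = 0") auto

lemma hom_eq_iff [simp]: "h x = h y \<longleftrightarrow> x = y"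
  using hom_eq_0_iff[of "x - y"] by (simp del: hom_eq_0_iff)

lemma hom_inverse [simp]: "h (inverse x) = inverse (h x)"
  using hom_mult[of x "inverse x"] by (cases "x = 0") (auto simp: inverse_unique)

lemma hom_divide [simp]: "h (x / y) = h x / h y"
  by (simp add: divide_inverse)

lemma hom_power [simp]: "h (x ^ n) = h x ^ n"
  by (induction n) auto

lemma hom_of_nat [simp]: "h (of_nat n) = of_nat n"
  by (induction n) auto

lemma hom_sum: "h (sum f S) = (\<Sum>x\<in>S. h (f x))"
  by (induction S rule: infinite_finite_induct) auto

lemma map_matrix_mult:
  "map_matrix h (M ** N) = map_matrix h M ** map_matrix h N"
  by (simp add: vec_eq_iff matrix_matrix_mult_def hom_sum)

lemma map_matrix_mat_1: "map_matrix h (mat 1) = mat 1"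
  by (simp add: vec_eq_iff mat_def)

lemma map_matrix_eq_iff: "map_matrix h M = map_matrix h N \<longleftrightarrow> M = N"
  by (simp add: vec_eq_iff)

text \<open>Serves to prove surjectivity: a range that contains generators is everything.\<close>

lemma is_subfield_range: "is_subfield (range h)"
  unfolding is_subfield_def
proof (intro conjI ballI)
  show "1 \<in> range h" by (metis hom_1 rangeI)
next
  fix x y assume "x \<in> range h" "y \<in> range h"
  then obtain u v where "x = h u" "y = h v" by auto
  then have "x - y = h (u - v)" "x * y = h (u * v)" by simp_all
  then show "x - y \<in> range h" "x * y \<in> range h" by blast+
next
  fix x assume "x \<in> range h"
  then obtain u where "x = h u" by auto
  then have "inverse x = h (inverse u)" by simp
  then show "inverse x \<in> range h" by blast
qed

end

locale derivation_on =
  fixes D :: "'a::field \<Rightarrow> 'a"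
  assumes der: "derivation D"
begin

lemma D_add [simp]: "D (x + y) = D x + D y"
  and D_mult: "D (x * y) = D x * y + x * D y"
  using der by (auto simp: derivation_def)

lemma D_0 [simp]: "D 0 = 0"
  by (metis D_add add.right_neutral add_left_cancel)

lemma D_1 [simp]: "D 1 = 0"
  using D_mult[of 1 1] by (metis mult_1 mult_1_right add.right_neutral add_left_cancel)

lemma D_uminus [simp]: "D (- x) = - D x"
  using D_add[of x "- x"] by (simp add: eq_neg_iff_add_eq_0 add.commute)

lemma D_diff [simp]: "D (x - y) = D x - D y"
  using D_add[of x "- y"] by simp

lemma D_sum: "D (sum f S) = (\<Sum>x\<in>S. D (f x))"
  by (induction S rule: infinite_finite_induct) auto

lemma D_inverse: "D (inverse x) = - D x / (x * x)"
proof (cases "x = 0")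
  case False
  then have "0 = D x * inverse x + x * D (inverse x)"
    using D_mult[of x "inverse x"] by simp
  then have "x * D (inverse x) = - D x * inverse x"
    by (simp add: eq_neg_iff_add_eq_0 add.commute)
  with False show ?thesis by (simp add: field_simps)
qed simp

lemma D_divide: "y \<noteq> 0 \<Longrightarrow> D (x / y) = (D x * y - x * D y) / (y * y)"
  by (simp add: divide_inverse D_mult D_inverse) (simp add: field_simps)

lemma D_power: "D (x ^ n) * x = of_nat n * D x * x ^ n"
  by (induction n) (simp_all add: D_mult algebra_simps)

lemma map_matrix_D_mult:
  "map_matrix D (M ** N) = map_matrix D M ** N + M ** map_matrix D N"
  by (simp add: vec_eq_iff matrix_matrix_mult_def D_sum D_mult sum.distrib)

text \<open>Reduces compatibility of \<open>\<sigma>\<close> with the derivation to a check on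
  generators.\<close>

lemma is_subfield_commuting:
  assumes "field_hom \<sigma>"
  shows "is_subfield {x. \<sigma> (D x) = D (\<sigma> x)}"
proof -
  interpret \<sigma>: field_homomorphism \<sigma> using assms by unfold_locales
  show ?thesis by (auto simp: is_subfield_def D_mult D_inverse)
qed

end

section \<open>Fundamental matrices and the effect of changing them\<close>

locale diff_field_extension =
  fixes \<iota> :: "ratfun \<Rightarrow> 'k::field" and D :: "'k \<Rightarrow> 'k"
  assumes ext: "diff_extension \<iota> D"

sublocale diff_field_extension \<subseteq> \<iota>: field_homomorphism \<iota>
  by unfold_locales (use ext in \<open>simp add: diff_extension_def\<close>)

sublocale diff_field_extension \<subseteq> derivation_on D
  by unfold_locales (use ext in \<open>simp add: diff_extension_def\<close>)

sublocale diff_field_extension \<subseteq> const: field_homomorphism "const_emb \<iota>"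
proof unfold_locales
  have 1: "to_fract [:1:] = (1::ratfun)" by (metis one_pCons to_fract_1)
  have 2: "to_fract [:x + y:] = to_fract [:x:] + to_fract [:y:]" for x y :: complex
    by (subst to_fract_add[symmetric]) simp
  have 3: "to_fract [:x * y:] = to_fract [:x:] * to_fract [:y:]" for x y :: complex
    by (subst to_fract_mult[symmetric]) simp
  show "field_hom (const_emb \<iota>)"
    by (simp add: field_hom_def 1 2 3)
qed

context diff_field_extension
begin

lemma D_\<iota> [simp]: "D (\<iota> f) = \<iota> (ratfun_deriv f)"
  using ext by (simp add: diff_extension_def)

lemma ratfun_deriv_const [simp]: "ratfun_deriv (to_fract [:c:]) = 0"
  by (simp add: to_fract_def ratfun_deriv_Fract pderiv_pCons fract_collapse)

lemma ratfun_deriv_linear [simp]: "ratfun_deriv (to_fract [:c, 1:]) = 1"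
  by (simp add: to_fract_def ratfun_deriv_Fract pderiv_pCons One_fract_def eq_fract)

text \<open>The sum and product rules are pulled back from \<open>D\<close> along the injective
  \<open>\<iota>\<close>, which avoids computing with representatives of fractions.\<close>

sublocale ratfun: derivation_on ratfun_deriv
proof unfold_locales
  have "\<iota> (ratfun_deriv (x + y)) = \<iota> (ratfun_deriv x + ratfun_deriv y)"
    "\<iota> (ratfun_deriv (x * y)) = \<iota> (ratfun_deriv x * y + x * ratfun_deriv y)" for x y
    by (simp_all flip: D_\<iota> add: D_mult)
  then show "derivation ratfun_deriv"
    by (simp add: derivation_def del: \<iota>.hom_add \<iota>.hom_mult)
qed

lemma D_matrix_eq_0_imp_const:
  assumes "{x. D x = 0} = range (const_emb \<iota>)" "map_matrix D C = 0"
  obtains C0 where "C = map_matrix (const_emb \<iota>) C0"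
proof -
  have "\<exists>c. C $ i $ j = const_emb \<iota> c" for i j
  proof -
    have "D (C $ i $ j) = 0" using assms(2) by (simp add: vec_eq_iff)
    then show ?thesis using assms(1) by blast
  qed
  then obtain c where "C $ i $ j = const_emb \<iota> (c i j)" for i j by metis
  then have "C = map_matrix (const_emb \<iota>) (\<chi> i j. c i j)" by (simp add: vec_eq_iff)
  then show ?thesis using that by blast
qed

text \<open>For C = E^(-1) F the product rule gives E D(C) = 0. Hence the entries of C are
  constants, and the extension has no constants beyond the complex numbers.\<close>

lemma fundamental_matrix_unique:
  assumes const: "{x. D x = 0} = range (const_emb \<iota>)"
    and F: "fundamental_matrix \<iota> D A F" and E: "fundamental_matrix \<iota> D A (E :: 'k^'n^'n)"
  obtains C where "invertible C" "F = E ** map_matrix (const_emb \<iota>) C"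
proof -
  have ex: "\<exists>C. F = E ** map_matrix (const_emb \<iota>) C"
    if F: "fundamental_matrix \<iota> D A F" and E: "fundamental_matrix \<iota> D A E" for E F :: "'k^'n^'n"
  proof -
    have inv: "invertible E" using E by (simp add: fundamental_matrix_def)
    define C where "C = matrix_inv E ** F"
    have FC: "F = E ** C"
      by (simp add: C_def matrix_mul_assoc matrix_inv_mult_self[OF inv])
    have "map_matrix D F = map_matrix \<iota> A ** F + E ** map_matrix D C"
      using E by (simp add: FC map_matrix_D_mult fundamental_matrix_def matrix_mul_assoc)
    then have "E ** map_matrix D C = 0"
      using F by (simp add: fundamental_matrix_def)
    then have "(matrix_inv E ** E) ** map_matrix D C = 0"
      by (simp flip: matrix_mul_assoc)
    then have "map_matrix D C = 0"
      by (simp add: matrix_inv_mult_self[OF inv])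
    then show ?thesis using D_matrix_eq_0_imp_const[OF const] FC by metis
  qed
  obtain C where C: "F = E ** map_matrix (const_emb \<iota>) C" using ex[OF F E] by blast
  obtain C' where C': "E = F ** map_matrix (const_emb \<iota>) C'" using ex[OF E F] by blast
  have inv: "invertible E" using E by (simp add: fundamental_matrix_def)
  \<comment> \<open>Exchanging E and F yields a second complex matrix. Cancelling E and using
    injectivity of the constant embedding shows that it is a right inverse over the complex numbers,
    not just over the extension.\<close>
  have "E = E ** (map_matrix (const_emb \<iota>) (C ** C'))"
    unfolding const.map_matrix_mult matrix_mul_assoc using C C' by simp
  then have "matrix_inv E ** E = (matrix_inv E ** E) ** (map_matrix (const_emb \<iota>) (C ** C'))"
    by (metis matrix_mul_assoc)
  then have "map_matrix (const_emb \<iota>) (C ** C') = map_matrix (const_emb \<iota>) (mat 1)"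
    by (simp add: matrix_inv_mult_self[OF inv] const.map_matrix_mat_1)
  then have "C ** C' = mat 1" by (simp only: const.map_matrix_eq_iff)
  then have "invertible C" using invertible_right_inverse by blast
  then show ?thesis using C that by blast
qed

text \<open>If \<open>\<sigma>\<close> sends E to E N, it fixes the complex matrix C and so sends F
  = E C to E N C = F (C^(-1) N C).\<close>

lemma galois_matrices_conjugate:
  assumes "invertible C" and inv: "invertible (E :: 'k^'n^'n)"
    and F: "F = E ** map_matrix (const_emb \<iota>) C"
  shows "galois_matrices \<iota> D E = (\<lambda>M. C ** M ** matrix_inv C) ` galois_matrices \<iota> D F"
proof -
  have CC: "C ** matrix_inv C = mat 1" "matrix_inv C ** C = mat 1"
    using matrix_inv_mult_self[OF assms(1)] by simp_all
  have CC': "map_matrix (const_emb \<iota>) C ** map_matrix (const_emb \<iota>) (matrix_inv C) = mat 1"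
     "map_matrix (const_emb \<iota>) (matrix_inv C) ** map_matrix (const_emb \<iota>) C = mat 1"
    unfolding const.map_matrix_mult[symmetric] by (simp_all add: CC const.map_matrix_mat_1)
  have E: "E = F ** map_matrix (const_emb \<iota>) (matrix_inv C)"
    by (simp add: F CC' flip: matrix_mul_assoc)
  \<comment> \<open>Stated for a generic pair of mutually inverse matrices because it is used twice:
    with C to pass from E to F, and with the inverse of C to pass back.\<close>
  have *: "map_matrix \<sigma> (E' ** map_matrix (const_emb \<iota>) C')
       = (E' ** map_matrix (const_emb \<iota>) C') ** map_matrix (const_emb \<iota>) (B' ** N ** C')"
    if \<sigma>: "\<sigma> \<in> diff_automorphisms \<iota> D" and C': "C' ** B' = mat 1"
      and N: "map_matrix \<sigma> E' = E' ** map_matrix (const_emb \<iota>) N"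
    for \<sigma> and E' :: "'k^'n^'n" and N and B' C' :: "complex^'n^'n"
  proof -
    interpret \<sigma>: field_homomorphism \<sigma>
      using \<sigma> by unfold_locales (simp add: diff_automorphisms_def)
    have "map_matrix \<sigma> (map_matrix (const_emb \<iota>) C') = map_matrix (const_emb \<iota>) C'"
      using \<sigma> by (simp add: vec_eq_iff diff_automorphisms_def)
    have "map_matrix (const_emb \<iota>) C' ** map_matrix (const_emb \<iota>) B' = mat 1"
      unfolding const.map_matrix_mult[symmetric] by (simp add: C' const.map_matrix_mat_1)
    then have "E' ** map_matrix (const_emb \<iota>) C' ** (map_matrix (const_emb \<iota>) B' ** X)
        = E' ** X" for X :: "'k^'n^'n"
      by (simp only: matrix_mul_assoc matrix_mul_rid flip: matrix_mul_assoc[of E'])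
    with \<open>map_matrix \<sigma> (map_matrix (const_emb \<iota>) C') = map_matrix (const_emb \<iota>) C'\<close>
    show ?thesis
      by (simp only: \<sigma>.map_matrix_mult const.map_matrix_mult N flip: matrix_mul_assoc)
  qed
  show ?thesis
  proof (intro equalityI subsetI)
    fix N assume "N \<in> galois_matrices \<iota> D E"
    then obtain \<sigma> where "\<sigma> \<in> diff_automorphisms \<iota> D"
      "map_matrix \<sigma> E = E ** map_matrix (const_emb \<iota>) N"
      by (auto simp: galois_matrices_def)
    from *[OF this(1) CC(1) this(2)] this(1)
    have "matrix_inv C ** N ** C \<in> galois_matrices \<iota> D F"
      by (auto simp: galois_matrices_def F)
    moreover have "N = C ** (matrix_inv C ** N ** C) ** matrix_inv C"
      by (simp add: matrix_mul_assoc CC) (simp add: CC flip: matrix_mul_assoc)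
    ultimately show "N \<in> (\<lambda>M. C ** M ** matrix_inv C) ` galois_matrices \<iota> D F" by blast
  next
    fix N assume "N \<in> (\<lambda>M. C ** M ** matrix_inv C) ` galois_matrices \<iota> D F"
    then obtain \<sigma> M where "\<sigma> \<in> diff_automorphisms \<iota> D"
      "map_matrix \<sigma> F = F ** map_matrix (const_emb \<iota>) M" "N = C ** M ** matrix_inv C"
      by (auto simp: galois_matrices_def)
    with *[OF this(1) CC(2) this(2)] E show "N \<in> galois_matrices \<iota> D E"
      by (auto simp: galois_matrices_def)
  qed
qed

end

section \<open>Adjoining a power of a linear function\<close>

text \<open>This is the multiplicative group of all nonzero complex numbers if r is irrational, and
  the group of N-th roots of unity if r is rational with reduced denominator N.\<close>

definition power_multipliers :: "complex \<Rightarrow> complex set" where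
  "power_multipliers r = {c. c \<noteq> 0 \<and> (\<forall>n. of_nat n * r \<in> \<int> \<longrightarrow> c ^ n = 1)}"

lemma inverse_power_multipliers: "c \<in> power_multipliers r \<Longrightarrow> inverse c \<in> power_multipliers r"
  by (auto simp: power_multipliers_def power_inverse)

text \<open>An abstract model of C(t, (t - t0)^r): y is known only through its first-order equation,
  the absence of new constants, and generation, expressed as minimality among subfields. Nothing is
  assumed on whether y is algebraic.\<close>

locale power_extension = diff_field_extension \<iota> D
  for \<iota> :: "ratfun \<Rightarrow> 'k::field" and D :: "'k \<Rightarrow> 'k" +
  fixes t0 r :: complex and y :: 'k
  assumes constants: "{x. D x = 0} = range (const_emb \<iota>)"
    and y_nz: "y \<noteq> 0"
    and D_y: "\<iota> (to_fract [:-t0, 1:]) * D y = const_emb \<iota> r * y"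
    and gen: "\<And>K. is_subfield K \<Longrightarrow> range \<iota> \<subseteq> K \<Longrightarrow> y \<in> K \<Longrightarrow> K = UNIV"
begin

abbreviation (input) \<tau> :: ratfun where "\<tau> \<equiv> to_fract [:-t0, 1:]"

definition ev :: "ratfun poly \<Rightarrow> 'k \<Rightarrow> 'k" where
  "ev P x = poly (map_poly \<iota> P) x"

lemma ev_0 [simp]: "ev 0 x = 0"
  and ev_pCons [simp]: "ev (pCons a P) x = \<iota> a + x * ev P x"
  by (simp_all add: ev_def map_poly_pCons)

lemma ev_1 [simp]: "ev 1 x = 1"
  unfolding one_pCons by simp

lemma ev_add [simp]: "ev (P + Q) x = ev P x + ev Q x"
  by (induction P Q rule: poly_induct2) (auto simp: algebra_simps)

lemma ev_smult [simp]: "ev (smult a P) x = \<iota> a * ev P x"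
  by (induction P) (auto simp: algebra_simps)

lemma ev_mult [simp]: "ev (P * Q) x = ev P x * ev Q x"
  by (induction P) (auto simp: algebra_simps)

lemma ev_uminus [simp]: "ev (- P) x = - ev P x"
  by (induction P) (auto simp: algebra_simps)

lemma ev_diff [simp]: "ev (P - Q) x = ev P x - ev Q x"
  using ev_add[of P "- Q"] by simp

text \<open>Since \<open>\<tau>\<close> D y = r y, the derivation \<open>\<tau>\<close> D acts on
  the coefficients as \<open>\<tau>\<close> d/dt and on powers of y as the Euler operator r X d/dX;
  \<open>pCons 0 (pderiv P)\<close> is X P'. The factor \<open>\<tau>\<close> keeps the result
  polynomial in y.\<close>

lemma D_ev:
  "\<iota> \<tau> * D (ev P y) = ev (smult \<tau> (map_poly ratfun_deriv P) + smult (to_fract [:r:]) (pCons 0 (pderiv P))) y"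
proof (induction P)
  case 0
  then show ?case by simp
next
  case (pCons a P)
  have "\<iota> \<tau> * D (ev (pCons a P) y)
    = \<iota> \<tau> * \<iota> (ratfun_deriv a) + (\<iota> \<tau> * D y) * ev P y + y * (\<iota> \<tau> * D (ev P y))"
    by (simp add: D_mult algebra_simps del: \<iota>.hom_eq_0_iff)
  also have "\<dots> = ev (smult \<tau> (map_poly ratfun_deriv (pCons a P))
      + smult (to_fract [:r:]) (pCons 0 (pderiv (pCons a P)))) y"
    unfolding pCons.IH D_y by (simp add: map_poly_pCons pderiv_pCons algebra_simps)
  finally show ?case .
qed

text \<open>If \<open>P\<close> is the minimal polynomial of \<open>y\<close>, then applying \<open>\<tau> D - d r\<close> to the relation
  \<open>P(y) = 0\<close> gives one of smaller degree, which must vanish identically. Hence each nonzero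
  coefficient \<open>c\<close> of \<open>P\<close> at degree \<open>k\<close> satisfies \<open>\<tau> c' = (d - k) r c\<close>, so that \<open>(d - k) r\<close> is an
  integer.\<close>

lemma minimal_polynomial_coeff:
  assumes P: "ev P y = 0" "lead_coeff P = 1"
    and min: "\<And>Q. ev Q y = 0 \<Longrightarrow> degree Q < degree P \<Longrightarrow> Q = 0"
    and nz: "coeff P k \<noteq> 0"
  shows "of_nat (degree P - k) * r \<in> \<int>"
proof -
  define d where "d = degree P"
  have k: "k \<le> d" using nz le_degree d_def by blast
  have const_mult: "to_fract [:x:] * to_fract [:z:] = to_fract [:x * z:]" for x z :: complex
    by (subst to_fract_mult[symmetric]) simp
  have of_nat_const: "of_nat n = (to_fract [:of_nat n:] :: ratfun)" for n
    by (simp add: to_fract_def of_nat_fract of_nat_poly)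
  define R where "R = smult \<tau> (map_poly ratfun_deriv P)
     + smult (to_fract [:r:]) (pCons 0 (pderiv P)) - smult (to_fract [:of_nat d * r:]) P"
  have coeff_R: "coeff R j = \<tau> * ratfun_deriv (coeff P j)
      + to_fract [:of_nat j * r:] * coeff P j - to_fract [:of_nat d * r:] * coeff P j" for j
    by (cases j) (simp_all add: R_def coeff_map_poly coeff_pderiv algebra_simps of_nat_const
        const_mult del: of_nat_Suc flip: mult.assoc)
  have "ev R y = \<iota> \<tau> * D (ev P y) - \<iota> (to_fract [:of_nat d * r:]) * ev P y"
    unfolding R_def D_ev by simp
  then have R0: "ev R y = 0" using P by simp
  have "coeff R j = 0" if "j \<ge> d" for j
    using that P(2) by (cases "j = d") (auto simp: coeff_R d_def coeff_eq_0)
  then have "R = 0 \<or> degree R < d"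
    by (metis leading_coeff_0_iff linorder_not_le)
  then have "R = 0" using min R0 d_def by blast
  then have "\<tau> * ratfun_deriv (coeff P k)
     = (to_fract [:of_nat d * r:] - to_fract [:of_nat k * r:]) * coeff P k"
    using coeff_R[of k] by (simp add: algebra_simps)
  also have "to_fract [:of_nat d * r:] - to_fract [:of_nat k * r:] = to_fract [:of_nat (d - k) * r:]"
    using k by (subst to_fract_diff[symmetric]) (simp add: of_nat_diff algebra_simps)
  finally show ?thesis
    using ratfun_log_deriv_Ints[OF nz] d_def by blast
qed

lemma ev_eq_sum: "ev P x = (\<Sum>k\<le>degree P. \<iota> (coeff P k) * x ^ k)"
  by (simp add: ev_def poly_altdef coeff_map_poly degree_map_poly)

text \<open>Every relation of y is a multiple of a monic relation Q of least degree n. Where Q has a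
  nonzero coefficient of degree k, (n - k) r is an integer, so c^k = c^n. Hence Q(c y) = c^n Q(y) =
  0.\<close>

lemma ev_scaled_eq_0:
  assumes c: "c \<in> power_multipliers r" and "ev P y = 0"
  shows "ev P (const_emb \<iota> c * y) = 0"
\<comment> \<open>A nonzero P witnesses that y is algebraic, so a relation of least degree exists;
  for transcendental y only the case P = 0 arises.\<close>
proof (cases "P = 0")
  case False
  define n where "n = (LEAST n. \<exists>Q. Q \<noteq> 0 \<and> ev Q y = 0 \<and> degree Q = n)"
  have ex: "\<exists>Q. Q \<noteq> 0 \<and> ev Q y = 0 \<and> degree Q = n"
    unfolding n_def by (rule LeastI[of _ "degree P"]) (use False assms in auto)
  have min: "Q = 0" if "ev Q y = 0" "degree Q < n" for Q
    using not_less_Least[of "degree Q" "\<lambda>n. \<exists>Q. Q \<noteq> 0 \<and> ev Q y = 0 \<and> degree Q = n"] that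
    unfolding n_def by blast
  from ex obtain Q0 where Q0: "Q0 \<noteq> 0" "ev Q0 y = 0" "degree Q0 = n" by blast
  define Q where "Q = smult (inverse (lead_coeff Q0)) Q0"
  have Q: "ev Q y = 0" "lead_coeff Q = 1" "degree Q = n" "Q \<noteq> 0"
    using Q0 by (auto simp: Q_def)
  have "ev (P mod Q) y = 0"
    using assms Q(1) by (simp flip: minus_div_mult_eq_mod)
  moreover have "degree (P mod Q) < n \<or> P mod Q = 0"
    using degree_mod_less[OF Q(4), of P] Q(3) by auto
  ultimately have "P mod Q = 0" using min by blast
  then have P: "P = P div Q * Q" by (metis add.right_neutral div_mult_mod_eq)
  have "const_emb \<iota> c ^ k * \<iota> (coeff Q k) = const_emb \<iota> c ^ n * \<iota> (coeff Q k)"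
    if "k \<le> n" for k
  proof (cases "coeff Q k = 0")
    case nz: False
    have "of_nat (n - k) * r \<in> \<int>"
      using minimal_polynomial_coeff[OF Q(1,2) _ nz] min Q(3) by simp
    then have "c ^ (n - k) = 1" using c by (auto simp: power_multipliers_def)
    then have "const_emb \<iota> c ^ (n - k) = 1" by (metis const.hom_1 const.hom_power)
    then have "const_emb \<iota> c ^ n = const_emb \<iota> c ^ k"
      using that by (metis le_add_diff_inverse mult.right_neutral power_add)
    then show ?thesis by simp
  qed simp
  then have "ev Q (const_emb \<iota> c * y) = (\<Sum>k\<le>n. const_emb \<iota> c ^ n * (\<iota> (coeff Q k) * y ^ k))"
    unfolding ev_eq_sum Q(3) by (intro sum.cong) (auto simp: power_mult_distrib)
  also have "\<dots> = const_emb \<iota> c ^ n * ev Q y"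
    by (simp add: ev_eq_sum Q(3) sum_distrib_left)
  finally have "ev Q (const_emb \<iota> c * y) = 0" using Q by simp
  then show ?thesis by (subst P) simp
qed simp

text \<open>The converse comes from scaling back: P(c X) vanishes at y, hence also at y / c, which
  gives P(y) = 0. It guarantees that denominators remain nonzero under the substitution.\<close>

lemma ev_scaled_eq_0_iff:
  assumes c: "c \<in> power_multipliers r"
  shows "ev P (const_emb \<iota> c * y) = 0 \<longleftrightarrow> ev P y = 0"
proof
  assume *: "ev P (const_emb \<iota> c * y) = 0"
  define P' where "P' = pcompose P [:0, to_fract [:c:]:]"
  have ev: "ev (pcompose Q [:0, a:]) x = ev Q (\<iota> a * x)" for Q a x
    by (induction Q) (simp_all add: pcompose_pCons algebra_simps)
  have "ev P' y = 0" using * by (simp add: P'_def ev)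
  from ev_scaled_eq_0[OF inverse_power_multipliers[OF c] this]
  have "ev P (const_emb \<iota> c * (const_emb \<iota> (inverse c) * y)) = 0"
    by (simp add: P'_def ev)
  moreover have "const_emb \<iota> c * const_emb \<iota> (inverse c) = 1"
    using c by (auto simp: power_multipliers_def)
  ultimately show "ev P y = 0" by (simp flip: mult.assoc)
qed (rule ev_scaled_eq_0[OF c])

section \<open>The automorphisms of C(t, y)\<close>

lemma quotient_ex: "\<exists>P Q. ev Q y \<noteq> 0 \<and> x = ev P y / ev Q y"
proof -
  define K where "K = {x. \<exists>P Q. ev Q y \<noteq> 0 \<and> x = ev P y / ev Q y}"
  have KI: "ev P y / ev Q y \<in> K" if "ev Q y \<noteq> 0" for P Q
    using that by (auto simp: K_def)
  have "is_subfield K"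
    unfolding is_subfield_def
  proof (intro conjI ballI)
    show "1 \<in> K" using KI[of 1 1] by simp
  next
    fix x z assume "x \<in> K" "z \<in> K"
    then obtain P Q P' Q' where *: "ev Q y \<noteq> 0" "x = ev P y / ev Q y"
      "ev Q' y \<noteq> 0" "z = ev P' y / ev Q' y" by (auto simp: K_def)
    then show "x - z \<in> K" "x * z \<in> K"
      using KI[of "Q * Q'" "P * Q' - P' * Q"] KI[of "Q * Q'" "P * P'"]
      by (simp_all add: diff_frac_eq)
  next
    fix x assume "x \<in> K"
    then obtain P Q where "ev Q y \<noteq> 0" "x = ev P y / ev Q y" by (auto simp: K_def)
    \<comment> \<open>The inverse of 0 is 0, written here as the quotient 0 / 1.\<close>
    then show "inverse x \<in> K"
      using KI[of P Q] KI[of 1 0] by (cases "ev P y = 0") auto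
  qed
  moreover have "range \<iota> \<subseteq> K"
    using KI[of 1 "[:f:]" for f] by auto
  moreover have "y \<in> K" using KI[of 1 "[:0, 1:]"] by simp
  ultimately have "K = UNIV" by (rule gen)
  then show ?thesis unfolding K_def by blast
qed

text \<open>The automorphism sends P(y) / Q(y) to P(c y) / Q(c y). This is well defined because the
  substitution preserves both the vanishing and the nonvanishing of polynomials in y.\<close>

lemma scaling_automorphism_ex:
  assumes c: "c \<in> power_multipliers r"
  shows "\<exists>\<sigma>\<in>diff_automorphisms \<iota> D. \<sigma> y = const_emb \<iota> c * y"
proof -
  let ?z = "const_emb \<iota> c * y"
  have nz: "ev Q ?z \<noteq> 0" if "ev Q y \<noteq> 0" for Q
    using ev_scaled_eq_0_iff[OF c] that by simp
  have cnz: "c \<noteq> 0" using c by (simp add: power_multipliers_def)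
  define \<sigma> where "\<sigma> x = (THE w. \<exists>P Q. ev Q y \<noteq> 0 \<and> x = ev P y / ev Q y \<and> w = ev P ?z / ev Q ?z)" for x
  have \<sigma>: "\<sigma> (ev P y / ev Q y) = ev P ?z / ev Q ?z" if Q: "ev Q y \<noteq> 0" for P Q
    unfolding \<sigma>_def
  proof (rule the_equality)
    fix w assume "\<exists>P' Q'. ev Q' y \<noteq> 0 \<and> ev P y / ev Q y = ev P' y / ev Q' y \<and> w = ev P' ?z / ev Q' ?z"
    then obtain P' Q' where *: "ev Q' y \<noteq> 0" "ev P y / ev Q y = ev P' y / ev Q' y"
      "w = ev P' ?z / ev Q' ?z" by blast
    then have "ev (P * Q' - P' * Q) y = 0" using Q by (simp add: frac_eq_eq)
    then have "ev (P * Q' - P' * Q) ?z = 0" using ev_scaled_eq_0[OF c] by blast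
    then show "w = ev P ?z / ev Q ?z"
      using * nz[OF Q] nz[OF *(1)] by (simp add: frac_eq_eq)
  qed (use Q in blast)
  have \<iota>: "\<sigma> (\<iota> f) = \<iota> f" for f using \<sigma>[of 1 "[:f:]"] by simp
  have y: "\<sigma> y = ?z" using \<sigma>[of 1 "[:0, 1:]"] by simp
  have "\<sigma> (x + w) = \<sigma> x + \<sigma> w \<and> \<sigma> (x * w) = \<sigma> x * \<sigma> w" for x w
  proof -
    obtain P Q where 1: "ev Q y \<noteq> 0" "x = ev P y / ev Q y" using quotient_ex by blast
    obtain P' Q' where 2: "ev Q' y \<noteq> 0" "w = ev P' y / ev Q' y" using quotient_ex by blast
    have eqs: "x + w = ev (P * Q' + P' * Q) y / ev (Q * Q') y" "x * w = ev (P * P') y / ev (Q * Q') y"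
      using 1 2 by (simp_all add: add_frac_eq)
    have QQ': "ev (Q * Q') y \<noteq> 0" using 1 2 by simp
    have "\<sigma> x = ev P ?z / ev Q ?z" "\<sigma> w = ev P' ?z / ev Q' ?z"
      "\<sigma> (x + w) = ev (P * Q' + P' * Q) ?z / ev (Q * Q') ?z"
      "\<sigma> (x * w) = ev (P * P') ?z / ev (Q * Q') ?z"
      unfolding eqs \<sigma>[OF QQ'] unfolding 1(2) 2(2) by (simp_all only: \<sigma>[OF 1(1)] \<sigma>[OF 2(1)])
    then show ?thesis
      using nz[OF 1(1)] nz[OF 2(1)] by (simp add: add_frac_eq)
  qed
  then have hom: "field_hom \<sigma>"
    using \<iota>[of 1] by (simp add: field_hom_def)
  interpret \<sigma>: field_homomorphism \<sigma> using hom by unfold_locales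
  \<comment> \<open>The range is a subfield containing C(t) and y, the latter being the image of y /
    c.\<close>
  have "range \<sigma> = UNIV"
  proof (rule gen[OF \<sigma>.is_subfield_range])
    show "range \<iota> \<subseteq> range \<sigma>" using \<iota> by (metis image_subsetI rangeI)
    have "\<sigma> (y / const_emb \<iota> c) = y" using cnz by (simp add: \<iota> y)
    then show "y \<in> range \<sigma>" by (metis rangeI)
  qed
  moreover have "inj \<sigma>" by (simp add: inj_def)
  ultimately have "bij \<sigma>" by (simp add: bij_def)
  moreover have "{x. \<sigma> (D x) = D (\<sigma> x)} = UNIV"
  proof (rule gen[OF is_subfield_commuting[OF hom]])
    show "range \<iota> \<subseteq> {x. \<sigma> (D x) = D (\<sigma> x)}" by (auto simp: \<iota>)
    have "D y = const_emb \<iota> r * y / \<iota> \<tau>"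
      using D_y by (simp add: field_simps)
    then show "y \<in> {x. \<sigma> (D x) = D (\<sigma> x)}"
      by (simp add: y \<iota> D_mult)
  qed
  ultimately have "\<sigma> \<in> diff_automorphisms \<iota> D"
    using hom \<iota> by (auto simp: diff_automorphisms_def)
  then show ?thesis using y by blast
qed

text \<open>When n r = k, this is the equation satisfied by y^n. The exponent k may be
  negative.\<close>

lemma \<tau>_D_power_int: "\<iota> \<tau> * D (\<iota> \<tau> powi k) = of_int k * \<iota> \<tau> powi k"
proof -
  have pow: "D (\<iota> \<tau> ^ n) * \<iota> \<tau> = of_nat n * \<iota> \<tau> ^ n" for n
    using D_power[of "\<iota> \<tau>" n] by simp
  show ?thesis
  proof (cases "k \<ge> 0")
    case True
    then show ?thesis using pow[of "nat k"] by (simp add: power_int_def mult.commute)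
  next
    case False
    have "\<iota> \<tau> powi k = inverse (\<iota> \<tau> ^ nat (- k))" using False by (simp add: power_int_def power_inverse)
    moreover have "\<iota> \<tau> * D (inverse (\<iota> \<tau> ^ n)) = - of_nat n * inverse (\<iota> \<tau> ^ n)" for n
      unfolding D_inverse using pow[of n] by (simp add: field_simps)
    ultimately show ?thesis using False by simp
  qed
qed

text \<open>Both y and its image solve the same first-order equation, so their quotient is a
  constant c. If n r = k is an integer, y^n is a constant multiple of \<open>\<tau>\<close>^k, hence
  lies in C(t) and is fixed; this forces c^n = 1.\<close>

lemma automorphism_scales:
  assumes \<sigma>: "\<sigma> \<in> diff_automorphisms \<iota> D"
  shows "\<exists>c\<in>power_multipliers r. \<sigma> y = const_emb \<iota> c * y"
proof -
  interpret \<sigma>: field_homomorphism \<sigma>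
    using \<sigma> by unfold_locales (simp add: diff_automorphisms_def)
  have \<sigma>\<iota>: "\<sigma> (\<iota> f) = \<iota> f" and \<sigma>D: "\<sigma> (D x) = D (\<sigma> x)" for f x
    using \<sigma> by (simp_all add: diff_automorphisms_def)
  have const: "x \<in> range (const_emb \<iota>)" if "D x = 0" for x using constants that by blast
  have "D y = const_emb \<iota> r * y / \<iota> \<tau>"
    using D_y by (simp add: field_simps)
  moreover from this have "D (\<sigma> y) = const_emb \<iota> r * \<sigma> y / \<iota> \<tau>"
    by (simp add: \<sigma>\<iota> flip: \<sigma>D)
  ultimately have "D (\<sigma> y / y) = 0" using y_nz by (simp add: D_divide)
  then obtain c where "\<sigma> y / y = const_emb \<iota> c" using const by blast
  then have c: "\<sigma> y = const_emb \<iota> c * y" using y_nz by (simp add: field_simps)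
  have "c ^ n = 1" if n: "of_nat n * r \<in> \<int>" for n
  proof -
    obtain k where k: "of_nat n * r = of_int k" using n by (auto simp: Ints_def)
    have of_int: "const_emb \<iota> (of_int k) = of_int k"
      by (cases k rule: int_cases2) (simp_all add: flip: const.hom_of_nat)
    define z where "z = \<iota> \<tau> powi k"
    have z_nz: "z \<noteq> 0" and z_\<sigma>: "\<sigma> z = z"
      by (simp_all add: z_def power_int_def \<sigma>\<iota> power_inverse)
    have "D (y ^ n) * y = of_nat n * D y * y ^ n" by (rule D_power)
    then have "\<iota> \<tau> * D (y ^ n) * y = of_nat n * (\<iota> \<tau> * D y) * y ^ n" by (simp add: ac_simps)
    also have "\<dots> = const_emb \<iota> (of_nat n * r) * y ^ n * y"
      unfolding D_y const.hom_mult const.hom_of_nat by (simp add: ac_simps)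
    finally have "\<iota> \<tau> * D (y ^ n) = of_int k * y ^ n"
      using y_nz k of_int by simp
    moreover have "\<iota> \<tau> * D z = of_int k * z"
      unfolding z_def by (rule \<tau>_D_power_int)
    ultimately have "\<iota> \<tau> * (D (y ^ n) * z - y ^ n * D z) = 0"
      by (simp add: algebra_simps)
    then have "D (y ^ n / z) = 0" using z_nz by (simp add: D_divide)
    then obtain e where "y ^ n / z = const_emb \<iota> e" using const by blast
    then have e: "y ^ n = const_emb \<iota> e * z" using z_nz by (simp add: field_simps)
    then have "\<sigma> (y ^ n) = y ^ n" using z_\<sigma> \<sigma>\<iota> by simp
    then have "const_emb \<iota> (c ^ n) = const_emb \<iota> 1"
      using c y_nz by (simp add: power_mult_distrib)
    then show "c ^ n = 1" by (simp only: const.hom_eq_iff)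
  qed
  moreover have "c \<noteq> 0" using c y_nz by (metis \<sigma>.hom_eq_0_iff const.hom_0 mult_zero_left)
  ultimately show ?thesis using c by (auto simp: power_multipliers_def)
qed

end

section \<open>The Galois group of the variational equation\<close>

lemma vector_4 [simp]:
  "(vector [x, y, z, w] :: 'a::zero^4) $ 1 = x"
  "(vector [x, y, z, w] :: 'a::zero^4) $ 2 = y"
  "(vector [x, y, z, w] :: 'a::zero^4) $ 3 = z"
  "(vector [x, y, z, w] :: 'a::zero^4) $ 4 = w"
  unfolding vector_def by simp_all

text \<open>The coefficient is parametrized by an exponent r of the Euler equation; the other
  exponent is 1 - r.\<close>

definition var_matrix :: "complex \<Rightarrow> complex \<Rightarrow> ratfun^4^4" where
  "var_matrix r t0 = vector
    [vector [0, 0, 1, 0],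
     vector [0, 0, 0, 1],
     vector [to_fract [:r * (r - 1):] / to_fract [:-t0, 1:] ^ 2, 0, 0, 0],
     vector [0, 0, 0, 0]]"

text \<open>The effect of replacing y by c y on the basis whose nonzero position components are y,
  1, T / y and T, with T = t - t0.\<close>

definition diag_matrix :: "complex \<Rightarrow> complex^4^4" where
  "diag_matrix c = vector
    [vector [c, 0, 0, 0], vector [0, 1, 0, 0], vector [0, 0, inverse c, 0], vector [0, 0, 0, 1]]"

lemma diag_matrix_commute: "diag_matrix c ** diag_matrix d = diag_matrix d ** diag_matrix c"
  by (simp add: vec_eq_iff forall_4 matrix_matrix_mult_def sum_4 diag_matrix_def)

context diff_field_extension
begin

text \<open>Finds y inside an arbitrary extension by applying the right-hand factor of the factored
  Euler operator to the columns of F.\<close>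

lemma var_matrix_power_solution:
  assumes F: "fundamental_matrix \<iota> D (var_matrix r t0) F"
  obtains y where "y \<noteq> 0" "\<iota> (to_fract [:-t0, 1:]) * D y = const_emb \<iota> r * y"
proof -
  define T where "T = \<iota> (to_fract [:-t0, 1:])"
  define R where "R = const_emb \<iota> r"
  have T: "T \<noteq> 0" "D T = 1" and R: "D R = 0" by (simp_all add: T_def R_def)
  have RR: "\<iota> (to_fract [:r * (r - 1):]) = R * (R - 1)"
    unfolding R_def by (simp only: const.hom_mult const.hom_diff const.hom_1)
  have "map_matrix D F = map_matrix \<iota> (var_matrix r t0) ** F"
    using F by (simp add: fundamental_matrix_def)
  then have D_entry: "D (F $ i $ j) = (map_matrix \<iota> (var_matrix r t0) ** F) $ i $ j" for i j
    by (metis nth_map_matrix)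
  have D1: "D (F $ 1 $ j) = F $ 3 $ j" and D3: "D (F $ 3 $ j) = R * (R - 1) / T\<^sup>2 * F $ 1 $ j" for j
    unfolding D_entry
    by (simp_all add: matrix_matrix_mult_def sum_4 var_matrix_def RR T_def[symmetric] R_def[symmetric])
  \<comment> \<open>The operator d - (1 - r) / T annihilates T^(1 - r) and maps T^r to a multiple of
    T^(r - 1); the missing factor T is restored at the end.\<close>
  define w where "w j = F $ 3 $ j - (1 - R) / T * F $ 1 $ j" for j
  have Dw: "D (w j) = (R - 1) / T * w j" for j
    unfolding w_def using T
    by (simp add: D_mult D_divide D1 D3 R) (simp add: field_simps power2_eq_square)
  obtain F' where F': "F ** F' = mat 1"
    using F by (auto simp: fundamental_matrix_def invertible_def)
  \<comment> \<open>Otherwise row 3 of F would be a multiple of row 1. Multiplying by the inverse of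
    F would then make the entry 1 at (3,3) a multiple of the entry 0 at (1,3).\<close>
  have "\<exists>j. w j \<noteq> 0"
  proof (rule ccontr)
    assume "\<nexists>j. w j \<noteq> 0"
    then have "F $ 3 $ j = (1 - R) / T * F $ 1 $ j" for j by (simp add: w_def)
    then have "(F ** F') $ 3 $ 3 = (1 - R) / T * (F ** F') $ 1 $ 3"
      by (simp add: matrix_matrix_mult_def sum_distrib_left mult.assoc)
    then show False by (simp add: F' mat_def)
  qed
  then obtain j where j: "w j \<noteq> 0" by blast
  have "T * w j \<noteq> 0" using j T by simp
  moreover have "T * D (T * w j) = R * (T * w j)"
    using T by (simp add: D_mult Dw) (simp add: field_simps)
  ultimately show ?thesis using that unfolding T_def R_def by blast
qed

text \<open>The columns are the solutions y and T / y of the Euler equation and 1 and T of xi2'' =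
  0; the lower rows hold their derivatives.\<close>

definition power_fundamental_matrix :: "complex \<Rightarrow> complex \<Rightarrow> 'k \<Rightarrow> 'k^4^4" where
  "power_fundamental_matrix r t0 y =
    (let T = \<iota> (to_fract [:-t0, 1:]); R = const_emb \<iota> r in vector
      [vector [y, 0, T / y, 0],
       vector [0, 1, 0, T],
       vector [R * y / T, 0, (1 - R) / y, 0],
       vector [0, 0, 0, 1]])"

lemma fundamental_power_fundamental_matrix:
  assumes y: "y \<noteq> 0" "\<iota> (to_fract [:-t0, 1:]) * D y = const_emb \<iota> r * y"
    and r: "2 * r \<noteq> 1"
  shows "fundamental_matrix \<iota> D (var_matrix r t0) (power_fundamental_matrix r t0 y)"
proof -
  define T where "T = \<iota> (to_fract [:-t0, 1:])"
  define R where "R = const_emb \<iota> r"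
  have T: "T \<noteq> 0" "D T = 1" and R: "D R = 0" by (simp_all add: T_def R_def)
  have RR: "\<iota> (to_fract [:r * (r - 1):]) = R * (R - 1)"
    unfolding R_def by (simp only: const.hom_mult const.hom_diff const.hom_1)
  have Dy: "D y = R * y / T" using y T by (simp add: T_def R_def field_simps)
  let ?F = "power_fundamental_matrix r t0 y"
  note F_def = power_fundamental_matrix_def T_def[symmetric] R_def[symmetric] Let_def
  have "const_emb \<iota> (1 - 2 * r) \<noteq> const_emb \<iota> 0" using r by (simp only: const.hom_eq_iff) simp
  moreover have "const_emb \<iota> (1 - 2 * r) = 1 - 2 * R"
    unfolding R_def by (metis const.hom_diff const.hom_1 const.hom_mult const.hom_of_nat of_nat_numeral)
  ultimately have S: "1 - 2 * R \<noteq> 0" by simp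
  \<comment> \<open>S is the Wronskian of y and T / y. It is nonzero exactly because the exponents r
    and 1 - r differ.\<close>
  define S where "S = 1 - 2 * R"
  have S_nz: "S \<noteq> 0" using S by (simp add: S_def)
  \<comment> \<open>Blockwise inverse: cofactors divided by S in coordinates 1 and 3, and a
    unipotent block in coordinates 2 and 4.\<close>
  define F' :: "'k^4^4" where "F' = vector
      [vector [(1 - R) / (y * S), 0, - (T / (y * S)), 0],
       vector [0, 1, 0, - T],
       vector [- (R * y / (T * S)), 0, y / S, 0],
       vector [0, 0, 0, 1]]"
  have "?F ** F' = mat 1"
    using S_nz y T
    by (simp add: vec_eq_iff forall_4 matrix_matrix_mult_def sum_4 F_def F'_def mat_def)
      (simp add: field_simps, simp add: S_def algebra_simps)
  then have "invertible ?F" using invertible_right_inverse by blast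
  moreover have "map_matrix D ?F = map_matrix \<iota> (var_matrix r t0) ** ?F"
    using T y
    by (simp add: vec_eq_iff forall_4 matrix_matrix_mult_def sum_4 F_def var_matrix_def
        T_def[symmetric] RR Dy R D_mult D_divide)
      (simp add: field_simps power2_eq_square)
  ultimately show ?thesis by (simp add: fundamental_matrix_def)
qed

text \<open>Generation by the entries of some fundamental matrix becomes generation by y: that
  matrix is the explicit one times a complex matrix, so its entries lie in every subfield containing
  C(t) and y.\<close>

lemma picard_vessiot_var_matrix:
  assumes pv: "picard_vessiot \<iota> D (var_matrix r t0)"
    and y: "y \<noteq> 0" "\<iota> (to_fract [:-t0, 1:]) * D y = const_emb \<iota> r * y"
    and r: "2 * r \<noteq> 1"
  shows "power_extension \<iota> D t0 r y"
proof unfold_locales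
  show constants: "{x. D x = 0} = range (const_emb \<iota>)"
    using pv by (simp add: picard_vessiot_def)
  show "y \<noteq> 0" "\<iota> (to_fract [:-t0, 1:]) * D y = const_emb \<iota> r * y" by (fact y)+
  fix K assume K: "is_subfield K" "range \<iota> \<subseteq> K" "y \<in> K"
  obtain F :: "'k^4^4" where F: "fundamental_matrix \<iota> D (var_matrix r t0) F"
    and gen: "\<forall>K. is_subfield K \<and> range \<iota> \<subseteq> K \<and> (\<forall>i j. F $ i $ j \<in> K) \<longrightarrow> K = UNIV"
    using pv unfolding picard_vessiot_def by (elim conjE exE)
  obtain C where C: "F = power_fundamental_matrix r t0 y ** map_matrix (const_emb \<iota>) C"
    using fundamental_matrix_unique[OF constants F fundamental_power_fundamental_matrix[OF y r]] by blast
  have diff: "x - z \<in> K" and mult: "x * z \<in> K"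
    if "x \<in> K" "z \<in> K" for x z
    using K(1) that by (auto simp: is_subfield_def)
  have inv: "inverse x \<in> K" if "x \<in> K" for x
    using K(1) that by (auto simp: is_subfield_def)
  have one: "1 \<in> K" using K(1) by (simp add: is_subfield_def)
  have \<iota>K: "\<iota> f \<in> K" for f using K(2) by blast
  have zero: "0 \<in> K" using \<iota>K[of 0] by simp
  have add: "x + z \<in> K" if "x \<in> K" "z \<in> K" for x z
    using diff[OF that(1) diff[OF zero that(2)]] by simp
  have "\<forall>i j. power_fundamental_matrix r t0 y $ i $ j \<in> K"
    unfolding forall_4 power_fundamental_matrix_def Let_def vector_4 divide_inverse
    by (intro conjI \<iota>K K(3) zero one mult inv diff)
  then have E: "power_fundamental_matrix r t0 y $ i $ j \<in> K" for i j by blast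
  have "F $ i $ j \<in> K" for i j
    unfolding C matrix_matrix_mult_def sum_4 vec_lambda_beta nth_map_matrix
    by (intro add mult E \<iota>K)
  then show "K = UNIV" using gen[rule_format, of K] K(1,2) by simp
qed

end

context power_extension
begin

lemma map_matrix_power_fundamental_matrix:
  assumes \<sigma>: "\<sigma> \<in> diff_automorphisms \<iota> D" and c: "\<sigma> y = const_emb \<iota> c * y" "c \<noteq> 0"
  shows "map_matrix \<sigma> (power_fundamental_matrix r t0 y)
    = power_fundamental_matrix r t0 y ** map_matrix (const_emb \<iota>) (diag_matrix c)"
proof -
  interpret \<sigma>: field_homomorphism \<sigma>
    using \<sigma> by unfold_locales (simp add: diff_automorphisms_def)
  have \<sigma>\<iota>: "\<sigma> (\<iota> f) = \<iota> f" for f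
    using \<sigma> by (simp add: diff_automorphisms_def)
  define T where "T = \<iota> (to_fract [:-t0, 1:])"
  define R where "R = const_emb \<iota> r"
  define d where "d = const_emb \<iota> c"
  have d: "d \<noteq> 0" using c(2) unfolding d_def by simp
  have *: "\<sigma> T = T" "\<sigma> R = R" "\<sigma> y = d * y" by (simp_all add: T_def R_def \<sigma>\<iota> c d_def)
  have inv: "const_emb \<iota> (inverse c) = inverse d" unfolding d_def by (rule const.hom_inverse)
  show ?thesis
    using d y_nz
    by (simp add: vec_eq_iff forall_4 matrix_matrix_mult_def sum_4 power_fundamental_matrix_def
        Let_def diag_matrix_def T_def[symmetric] R_def[symmetric] d_def[symmetric] inv *
        del: pCons_eq_0_iff)
      (simp add: field_simps)
qed

lemma galois_matrices_power_fundamental_matrix: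
  assumes r: "2 * r \<noteq> 1"
  shows "galois_matrices \<iota> D (power_fundamental_matrix r t0 y) = diag_matrix ` power_multipliers r"
proof -
  let ?F = "power_fundamental_matrix r t0 y"
  have inv: "invertible ?F"
    using fundamental_power_fundamental_matrix[OF y_nz D_y r] by (simp add: fundamental_matrix_def)
  show ?thesis
  proof (intro equalityI subsetI)
    fix M assume "M \<in> galois_matrices \<iota> D ?F"
    then obtain \<sigma> where \<sigma>: "\<sigma> \<in> diff_automorphisms \<iota> D"
      and M: "map_matrix \<sigma> ?F = ?F ** map_matrix (const_emb \<iota>) M"
      by (auto simp: galois_matrices_def)
    obtain c where c: "c \<in> power_multipliers r" "\<sigma> y = const_emb \<iota> c * y"
      using automorphism_scales[OF \<sigma>] by blast
    then have "c \<noteq> 0" by (simp add: power_multipliers_def)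
    then have "?F ** map_matrix (const_emb \<iota>) M = ?F ** map_matrix (const_emb \<iota>) (diag_matrix c)"
      using map_matrix_power_fundamental_matrix[OF \<sigma> c(2)] M by simp
    then have "matrix_inv ?F ** ?F ** map_matrix (const_emb \<iota>) M
        = matrix_inv ?F ** ?F ** map_matrix (const_emb \<iota>) (diag_matrix c)"
      by (simp flip: matrix_mul_assoc)
    then have "map_matrix (const_emb \<iota>) M = map_matrix (const_emb \<iota>) (diag_matrix c)"
      by (simp add: matrix_inv_mult_self[OF inv])
    then have "M = diag_matrix c" by (simp only: const.map_matrix_eq_iff)
    then show "M \<in> diag_matrix ` power_multipliers r" using c by blast
  next
    fix M assume "M \<in> diag_matrix ` power_multipliers r"
    then obtain c where c: "c \<in> power_multipliers r" "M = diag_matrix c" by blast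
    then have "c \<noteq> 0" by (simp add: power_multipliers_def)
    then show "M \<in> galois_matrices \<iota> D ?F"
      using scaling_automorphism_ex[OF c(1)] map_matrix_power_fundamental_matrix c(2)
      by (auto simp: galois_matrices_def)
  qed
qed

end

text \<open>The normal form mentions only r. Neither t0 nor the field carrying the extension
  survives, so groups computed in different extensions become comparable.\<close>

lemma diff_galois_group_var_matrix:
  assumes G: "diff_galois_group \<iota> D (var_matrix r t0) G" and r: "2 * r \<noteq> 1"
  shows "conjugate_in_GL G (diag_matrix ` power_multipliers r)"
proof -
  obtain F where pv: "picard_vessiot \<iota> D (var_matrix r t0)"
    and F: "fundamental_matrix \<iota> D (var_matrix r t0) F" and GF: "G = galois_matrices \<iota> D F"
    using G by (auto simp: diff_galois_group_def)
  interpret diff_field_extension \<iota> D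
    by unfold_locales (use pv in \<open>simp add: picard_vessiot_def\<close>)
  obtain y where y: "y \<noteq> 0" "\<iota> (to_fract [:-t0, 1:]) * D y = const_emb \<iota> r * y"
    using var_matrix_power_solution[OF F] by blast
  interpret power_extension \<iota> D t0 r y
    by (rule picard_vessiot_var_matrix[OF pv y r])
  let ?E = "power_fundamental_matrix r t0 y"
  have E: "fundamental_matrix \<iota> D (var_matrix r t0) ?E"
    by (rule fundamental_power_fundamental_matrix[OF y r])
  obtain C where C: "invertible C" "F = ?E ** map_matrix (const_emb \<iota>) C"
    using fundamental_matrix_unique[OF constants F E] by blast
  have "galois_matrices \<iota> D ?E = (\<lambda>M. C ** M ** matrix_inv C) ` G"
    unfolding GF using galois_matrices_conjugate[OF C(1) _ C(2)] E by (simp add: fundamental_matrix_def)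
  then show ?thesis
    using C(1) galois_matrices_power_fundamental_matrix[OF r] by (auto simp: conjugate_in_GL_def)
qed

section \<open>Conjugate matrix groups\<close>

lemma invertible_matrix_inv:
  "invertible (P :: 'a::semiring_1^'n^'n) \<Longrightarrow> invertible (matrix_inv P)"
  unfolding invertible_def[of "matrix_inv P"] using matrix_inv_mult_self[of P] by blast

lemma matrix_inv_eqI:
  fixes P :: "'a::semiring_1^'n^'n"
  assumes "P ** Q = mat 1" "Q ** P = mat 1"
  shows "matrix_inv P = Q"
proof -
  have "invertible P" using assms by (auto simp: invertible_def)
  then have "matrix_inv P ** (P ** Q) = Q"
    by (simp add: matrix_mul_assoc matrix_inv_mult_self)
  then show ?thesis by (simp add: assms)
qed

lemma conjugate_in_GL_sym:
  assumes "conjugate_in_GL G H"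
  shows "conjugate_in_GL H G"
proof -
  obtain P where P: "invertible P" and H: "H = (\<lambda>M. P ** M ** matrix_inv P) ` G"
    using assms by (auto simp: conjugate_in_GL_def)
  note inv = matrix_inv_mult_self[OF P]
  have "matrix_inv P ** (P ** M ** matrix_inv P) ** P = M" for M
    by (simp add: matrix_mul_assoc inv) (simp add: inv flip: matrix_mul_assoc)
  moreover have "matrix_inv (matrix_inv P) = P"
    using inv by (intro matrix_inv_eqI)
  ultimately have "G = (\<lambda>M. matrix_inv P ** M ** matrix_inv (matrix_inv P)) ` H"
    by (simp add: H image_image)
  then show ?thesis
    using invertible_matrix_inv[OF P] by (auto simp: conjugate_in_GL_def)
qed

lemma conjugate_in_GL_trans:
  fixes G H K :: "(complex^'n^'n) set"
  assumes "conjugate_in_GL G H" "conjugate_in_GL H K"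
  shows "conjugate_in_GL G K"
proof -
  obtain P where P: "invertible P" and H: "H = (\<lambda>M. P ** M ** matrix_inv P) ` G"
    using assms by (auto simp: conjugate_in_GL_def)
  obtain Q where Q: "invertible Q" and K: "K = (\<lambda>M. Q ** M ** matrix_inv Q) ` H"
    using assms by (auto simp: conjugate_in_GL_def)
  note inv = matrix_inv_mult_self[OF P] matrix_inv_mult_self[OF Q]
  have cancel: "matrix_inv Q ** (Q ** X) = X" "P ** (matrix_inv P ** X) = X"
    "Q ** (matrix_inv Q ** X) = X" "matrix_inv P ** (P ** X) = X" for X :: "complex^'n^'n"
    by (simp_all add: matrix_mul_assoc inv)
  have "(Q ** P) ** (matrix_inv P ** matrix_inv Q) = mat 1"
    "(matrix_inv P ** matrix_inv Q) ** (Q ** P) = mat 1"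
    by (simp_all add: cancel inv flip: matrix_mul_assoc)
  then have "invertible (Q ** P)" "matrix_inv (Q ** P) = matrix_inv P ** matrix_inv Q"
    by (auto simp: invertible_def intro: matrix_inv_eqI)
  moreover have "K = (\<lambda>M. (Q ** P) ** M ** (matrix_inv P ** matrix_inv Q)) ` G"
    by (simp add: K H image_image matrix_mul_assoc)
  ultimately show ?thesis by (auto simp: conjugate_in_GL_def)
qed

text \<open>Conjugation preserves commutativity, and the identity component is contained in the
  group.\<close>

lemma virtually_abelian_if_conjugate_to_commutative:
  fixes G H :: "(complex^'n^'n) set"
  assumes "conjugate_in_GL H G" and comm: "\<And>M N. M \<in> H \<Longrightarrow> N \<in> H \<Longrightarrow> M ** N = N ** M"
  shows "virtually_abelian G"
proof -
  obtain P where P: "invertible P" and G: "G = (\<lambda>M. P ** M ** matrix_inv P) ` H"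
    using assms by (auto simp: conjugate_in_GL_def)
  have "(P ** M ** matrix_inv P) ** (P ** N ** matrix_inv P) = P ** (M ** N) ** matrix_inv P" for M N
  proof -
    have "matrix_inv P ** (P ** X) = X" for X :: "complex^'n^'n"
      by (simp add: matrix_mul_assoc matrix_inv_mult_self[OF P])
    then show ?thesis by (simp flip: matrix_mul_assoc)
  qed
  then have "M ** N = N ** M" if "M \<in> G" "N \<in> G" for M N
    using that comm by (auto simp: G)
  moreover have "identity_component G \<subseteq> G"
    unfolding identity_component_def
    using connected_component_of_subset_topspace[of "subtopology zariski G" "mat 1"] by auto
  ultimately show ?thesis by (auto simp: virtually_abelian_def)
qed

section \<open>The variational equation along a curve of energy zero\<close>

lemma filterlim_exp_q2_to_0: "filterlim exp (at 0) q2_to_0"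
  by (rule filterlim_filtercomap)

text \<open>Needed for uniqueness of limits; it holds because \<open>exp\<close> reaches every
  nonzero number.\<close>

lemma q2_to_0_neq_bot: "q2_to_0 \<noteq> bot"
proof (rule filtercomap_neq_bot)
  fix P :: "complex \<Rightarrow> bool" assume P: "eventually P (at 0)"
  have "eventually (\<lambda>z::complex. z \<noteq> 0) (at 0)"
    by (simp add: eventually_at_filter)
  with P have "eventually (\<lambda>z. P z \<and> z \<noteq> 0) (at 0)" by (rule eventually_conj)
  then obtain z where "P z" "z \<noteq> 0" using eventually_happens'[OF at_neq_bot] by blast
  then have "P (exp (Ln z))" by simp
  then show "\<exists>x. P (exp x)" by blast
qed

text \<open>For real x, |exp (x w)| = |exp w|^x depends only on |q2|, so the limit is uniform over
  all branches.\<close>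

lemma tendsto_exp_mult_q2_to_0:
  assumes "x > 0"
  shows "((\<lambda>w. exp (complex_of_real x * w)) \<longlongrightarrow> 0) q2_to_0"
proof (rule tendsto_norm_zero_cancel)
  have "((\<lambda>w. exp w) \<longlongrightarrow> (0::complex)) q2_to_0"
    using filterlim_exp_q2_to_0 by (simp add: filterlim_at)
  then have "((\<lambda>w. norm (exp w :: complex) powr x) \<longlongrightarrow> 0) q2_to_0"
    using assms by (intro tendsto_zero_powrI[where b = x] tendsto_norm_zero) auto
  then show "((\<lambda>w. norm (exp (complex_of_real x * w))) \<longlongrightarrow> 0) q2_to_0"
    by (simp add: powr_def mult.commute)
qed

lemma power_branch_exp [simp]: "power_branch m w (exp w) = exp (of_real m * w)"
  by (simp add: power_branch_def)

text \<open>The side condition keeps \<open>Ln\<close> in \<open>power_branch\<close> off its branch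
  cut. At the base point \<open>exp w\<close> the quotient is 1.\<close>

lemma has_field_derivative_power_branch [derivative_intros]:
  assumes "(f has_field_derivative f') (at s)" and "f s / exp w \<notin> \<real>\<^sub>\<le>\<^sub>0"
  shows "((\<lambda>s. power_branch m w (f s)) has_field_derivative
    of_real m * power_branch m w (f s) / f s * f') (at s)"
proof -
  have "f s \<noteq> 0" using assms(2) by auto
  then show ?thesis
    unfolding power_branch_def using assms(2)
    by (auto intro!: derivative_eq_intros assms(1) simp: field_simps)
qed

lemma nth_add_axis:
  "(z + axis 1 s :: complex^4) $ 1 = z $ 1 + s" "(z + axis 1 s :: complex^4) $ 2 = z $ 2"
  "(z + axis 1 s :: complex^4) $ 3 = z $ 3" "(z + axis 1 s :: complex^4) $ 4 = z $ 4"
  "(z + axis 2 s :: complex^4) $ 1 = z $ 1" "(z + axis 2 s :: complex^4) $ 2 = z $ 2 + s"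
  "(z + axis 2 s :: complex^4) $ 3 = z $ 3" "(z + axis 2 s :: complex^4) $ 4 = z $ 4"
  "(z + axis 3 s :: complex^4) $ 1 = z $ 1" "(z + axis 3 s :: complex^4) $ 2 = z $ 2"
  "(z + axis 3 s :: complex^4) $ 3 = z $ 3 + s" "(z + axis 3 s :: complex^4) $ 4 = z $ 4"
  "(z + axis 4 s :: complex^4) $ 1 = z $ 1" "(z + axis 4 s :: complex^4) $ 2 = z $ 2"
  "(z + axis 4 s :: complex^4) $ 3 = z $ 3" "(z + axis 4 s :: complex^4) $ 4 = z $ 4 + s"
  by (simp_all add: axis_def)

section \<open>The Hamiltonian field and its Jacobian where q2 is nonzero\<close>

context
  fixes m :: real and a b w1 w2 :: complex
begin

definition pot_denom :: "complex \<Rightarrow> complex \<Rightarrow> complex" where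
  "pot_denom x1 x2 = a * power_branch m w1 x1 + b * power_branch m w2 x2"

definition regular_point :: "complex^4 \<Rightarrow> bool" where
  "regular_point z \<longleftrightarrow>
     z $ 1 / exp w1 \<notin> \<real>\<^sub>\<le>\<^sub>0 \<and> z $ 2 / exp w2 \<notin> \<real>\<^sub>\<le>\<^sub>0 \<and> pot_denom (z $ 1) (z $ 2) \<noteq> 0"

text \<open>The right-hand side for the derivative of p1. The power q1^(m - 1) is written as q1^m /
  q1 so that a single chosen branch occurs.\<close>

definition force1 :: "complex \<Rightarrow> complex \<Rightarrow> complex" where
  "force1 x1 x2 = - (a * m * power_branch m w1 x1 / (x1 * (pot_denom x1 x2)\<^sup>2))"

definition force2 :: "complex \<Rightarrow> complex \<Rightarrow> complex" where
  "force2 x1 x2 = - (b * m * power_branch m w2 x2 / (x2 * (pot_denom x1 x2)\<^sup>2))"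

lemma partial_deriv_ham_p:
  "partial_deriv 3 (ham m a b w1 w2) z = z $ 3"
  "partial_deriv 4 (ham m a b w1 w2) z = z $ 4"
  unfolding partial_deriv_def ham_def nth_add_axis
  by (rule DERIV_imp_deriv; auto intro!: derivative_eq_intros)+

lemma partial_deriv_ham_q:
  assumes "regular_point z"
  shows "partial_deriv 1 (ham m a b w1 w2) z = - force1 (z $ 1) (z $ 2)"
    and "partial_deriv 2 (ham m a b w1 w2) z = - force2 (z $ 1) (z $ 2)"
proof -
  have reg: "z $ 1 / exp w1 \<notin> \<real>\<^sub>\<le>\<^sub>0" "z $ 2 / exp w2 \<notin> \<real>\<^sub>\<le>\<^sub>0"
    "a * power_branch m w1 (z $ 1) + b * power_branch m w2 (z $ 2) \<noteq> 0"
    using assms by (simp_all add: regular_point_def pot_denom_def)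
  have "z $ 1 \<noteq> 0" "z $ 2 \<noteq> 0" using reg by auto
  with reg show "partial_deriv 1 (ham m a b w1 w2) z = - force1 (z $ 1) (z $ 2)"
    "partial_deriv 2 (ham m a b w1 w2) z = - force2 (z $ 1) (z $ 2)"
    unfolding partial_deriv_def ham_def nth_add_axis force1_def force2_def pot_denom_def
    by (auto intro!: DERIV_imp_deriv derivative_eq_intros simp: power2_eq_square)
qed

lemma hamiltonian_field_ham:
  "hamiltonian_field (ham m a b w1 w2) z $ 1 = z $ 3"
  "hamiltonian_field (ham m a b w1 w2) z $ 2 = z $ 4"
  "regular_point z \<Longrightarrow> hamiltonian_field (ham m a b w1 w2) z $ 3 = force1 (z $ 1) (z $ 2)"
  "regular_point z \<Longrightarrow> hamiltonian_field (ham m a b w1 w2) z $ 4 = force2 (z $ 1) (z $ 2)"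
  by (simp_all add: hamiltonian_field_def partial_deriv_ham_p partial_deriv_ham_q)

lemma eventually_regular_point:
  assumes z: "regular_point z"
  shows "\<forall>\<^sub>F s in nhds 0. regular_point (z + axis j s)"
proof -
  have lim: "((\<lambda>s. (z + axis j s) $ i) \<longlongrightarrow> z $ i) (nhds 0)" for i
  proof -
    have "isCont (\<lambda>s. (z + axis j s) $ i) 0"
      by (cases "i = j") (simp_all add: axis_def)
    then have "((\<lambda>s. (z + axis j s) $ i) \<longlongrightarrow> (z + axis j 0) $ i) (nhds 0)"
      by (simp only: isCont_def tendsto_at_iff_tendsto_nhds[of "\<lambda>s. (z + axis j s) $ i" 0])
    moreover have "(z + axis j 0) $ i = z $ i" by (simp add: axis_def)
    ultimately show ?thesis by simp
  qed
  have pb: "isCont (power_branch m w) x" if "x / exp w \<notin> \<real>\<^sub>\<le>\<^sub>0" for x w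
    using has_field_derivative_power_branch[of "\<lambda>s. s" 1 x w m] that
    by (auto intro: DERIV_isCont)
  have slit: "\<forall>\<^sub>F s in nhds 0. (z + axis j s) $ i / exp w \<notin> \<real>\<^sub>\<le>\<^sub>0" if "z $ i / exp w \<notin> \<real>\<^sub>\<le>\<^sub>0" for i w
  proof -
    have "((\<lambda>s. (z + axis j s) $ i / exp w) \<longlongrightarrow> z $ i / exp w) (nhds 0)"
      by (intro tendsto_intros lim) simp
    moreover have "open (- \<real>\<^sub>\<le>\<^sub>0 :: complex set)" by (simp add: open_Compl)
    ultimately have "\<forall>\<^sub>F s in nhds 0. (z + axis j s) $ i / exp w \<in> - \<real>\<^sub>\<le>\<^sub>0"
      using that by (intro topological_tendstoD) auto
    then show ?thesis by simp
  qed
  have "((\<lambda>s. pot_denom ((z + axis j s) $ 1) ((z + axis j s) $ 2)) \<longlongrightarrow> pot_denom (z $ 1) (z $ 2)) (nhds 0)"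
    unfolding pot_denom_def using z
    by (intro tendsto_intros isCont_tendsto_compose[OF pb] lim) (auto simp: regular_point_def)
  then have "\<forall>\<^sub>F s in nhds 0. pot_denom ((z + axis j s) $ 1) ((z + axis j s) $ 2) \<noteq> 0"
    using z by (intro tendsto_imp_eventually_ne) (auto simp: regular_point_def)
  then show ?thesis
    using slit[of 1 w1] slit[of 2 w2] z unfolding regular_point_def
    by (intro eventually_conj) simp_all
qed

text \<open>Differentiating the field requires its closed form near the point and not only at it;
  regularity is an open condition, so F may replace the field component along the axis.\<close>

lemma jacobian_ham:
  assumes z: "regular_point z"
    and DF: "((\<lambda>s. F (z + axis j s)) has_field_derivative F') (at 0)"
    and F: "\<And>z. regular_point z \<Longrightarrow> hamiltonian_field (ham m a b w1 w2) z $ i = F z"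
  shows "jacobian (hamiltonian_field (ham m a b w1 w2)) z $ i $ j = F'"
proof -
  have "\<forall>\<^sub>F s in nhds 0. hamiltonian_field (ham m a b w1 w2) (z + axis j s) $ i = F (z + axis j s)"
    using eventually_regular_point[OF z] by eventually_elim (rule F)
  then have "deriv (\<lambda>s. hamiltonian_field (ham m a b w1 w2) (z + axis j s) $ i) 0
      = deriv (\<lambda>s. F (z + axis j s)) 0"
    by (rule deriv_cong_ev) simp
  also have "\<dots> = F'" using DF by (rule DERIV_imp_deriv)
  finally show ?thesis by (simp add: jacobian_def partial_deriv_def)
qed

text \<open>The powers of q2 are grouped as \<open>Q / exp w2\<close> and
  \<open>Q / (exp w2)\<^sup>2\<close>, that is q2^(m - 1) and q2^(m - 2), because these are the
  quantities that tend to 0.\<close>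

lemma jacobian_ham_entries:
  fixes z :: "complex^4" and J :: "complex^4^4" and P Q N :: complex
  assumes z: "z $ 1 = exp w1" "z $ 2 = exp w2" and nz: "pot_denom (exp w1) (exp w2) \<noteq> 0"
  defines "J \<equiv> jacobian (hamiltonian_field (ham m a b w1 w2)) z"
    and "P \<equiv> exp (of_real m * w1)" and "Q \<equiv> exp (of_real m * w2)"
  defines "N \<equiv> a * P + b * Q"
  shows "J $ 1 $ 1 = 0" "J $ 1 $ 2 = 0" "J $ 1 $ 3 = 1" "J $ 1 $ 4 = 0"
    "J $ 2 $ 1 = 0" "J $ 2 $ 2 = 0" "J $ 2 $ 3 = 0" "J $ 2 $ 4 = 1"
    "J $ 3 $ 3 = 0" "J $ 3 $ 4 = 0" "J $ 4 $ 3 = 0" "J $ 4 $ 4 = 0"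
    "J $ 3 $ 1 = 2 * a\<^sup>2 * m\<^sup>2 * P\<^sup>2 / ((exp w1)\<^sup>2 * N ^ 3) - a * m * (m - 1) * P / ((exp w1)\<^sup>2 * N\<^sup>2)"
    "J $ 3 $ 2 = 2 * a * b * m\<^sup>2 * P * (Q / exp w2) / (exp w1 * N ^ 3)"
    "J $ 4 $ 1 = 2 * a * b * m\<^sup>2 * P * (Q / exp w2) / (exp w1 * N ^ 3)"
    "J $ 4 $ 2 = 2 * b\<^sup>2 * m\<^sup>2 * (Q / exp w2)\<^sup>2 / N ^ 3 - b * m * (m - 1) * (Q / (exp w2)\<^sup>2) / N\<^sup>2"
proof -
  have reg: "regular_point z" using z nz by (simp add: regular_point_def)
  have N: "N \<noteq> 0" "a * P + b * Q = N" using nz by (simp_all add: N_def P_def Q_def pot_denom_def)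
  have D31: "((\<lambda>s. force1 (exp w1 + s) (exp w2)) has_field_derivative
     2 * a\<^sup>2 * m\<^sup>2 * P\<^sup>2 / ((exp w1)\<^sup>2 * N ^ 3) - a * m * (m - 1) * P / ((exp w1)\<^sup>2 * N\<^sup>2)) (at 0)"
    unfolding force1_def pot_denom_def
    by (rule derivative_eq_intros refl | simp add: N flip: P_def Q_def)+
      (use N in \<open>simp add: divide_simps power2_eq_square power3_eq_cube algebra_simps\<close>)
  have D32: "((\<lambda>s. force1 (exp w1) (exp w2 + s)) has_field_derivative
     2 * a * b * m\<^sup>2 * P * (Q / exp w2) / (exp w1 * N ^ 3)) (at 0)"
    unfolding force1_def pot_denom_def
    by (rule derivative_eq_intros refl | simp add: N flip: P_def Q_def)+
      (use N in \<open>simp add: divide_simps power2_eq_square power3_eq_cube algebra_simps\<close>)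
  have D41: "((\<lambda>s. force2 (exp w1 + s) (exp w2)) has_field_derivative
     2 * a * b * m\<^sup>2 * P * (Q / exp w2) / (exp w1 * N ^ 3)) (at 0)"
    unfolding force2_def pot_denom_def
    by (rule derivative_eq_intros refl | simp add: N flip: P_def Q_def)+
      (use N in \<open>simp add: divide_simps power2_eq_square power3_eq_cube algebra_simps\<close>)
  have D42: "((\<lambda>s. force2 (exp w1) (exp w2 + s)) has_field_derivative
     2 * b\<^sup>2 * m\<^sup>2 * (Q / exp w2)\<^sup>2 / N ^ 3 - b * m * (m - 1) * (Q / (exp w2)\<^sup>2) / N\<^sup>2) (at 0)"
    unfolding force2_def pot_denom_def
    by (rule derivative_eq_intros refl | simp add: N flip: P_def Q_def)+
      (use N in \<open>simp add: divide_simps power2_eq_square power3_eq_cube algebra_simps\<close>)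
  have J1: "J $ 1 $ j = c" if "((\<lambda>s. (z + axis j s) $ 3) has_field_derivative c) (at 0)" for j c
    unfolding J_def by (rule jacobian_ham[OF reg that]) (rule hamiltonian_field_ham)
  show "J $ 1 $ 1 = 0" "J $ 1 $ 2 = 0" "J $ 1 $ 3 = 1" "J $ 1 $ 4 = 0"
    by (rule J1; unfold nth_add_axis; auto intro!: derivative_eq_intros)+
  have J2: "J $ 2 $ j = c" if "((\<lambda>s. (z + axis j s) $ 4) has_field_derivative c) (at 0)" for j c
    unfolding J_def by (rule jacobian_ham[OF reg that]) (rule hamiltonian_field_ham)
  show "J $ 2 $ 1 = 0" "J $ 2 $ 2 = 0" "J $ 2 $ 3 = 0" "J $ 2 $ 4 = 1"
    by (rule J2; unfold nth_add_axis; auto intro!: derivative_eq_intros)+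
  have J3: "J $ 3 $ j = c"
    if "((\<lambda>s. force1 ((z + axis j s) $ 1) ((z + axis j s) $ 2)) has_field_derivative c) (at 0)" for j c
    unfolding J_def
    by (rule jacobian_ham[where F = "\<lambda>z. force1 (z $ 1) (z $ 2)", OF reg that])
      (rule hamiltonian_field_ham)
  show "J $ 3 $ 3 = 0" "J $ 3 $ 4 = 0"
    by (rule J3, unfold nth_add_axis, rule DERIV_const)+
  have J4: "J $ 4 $ j = c"
    if "((\<lambda>s. force2 ((z + axis j s) $ 1) ((z + axis j s) $ 2)) has_field_derivative c) (at 0)" for j c
    unfolding J_def
    by (rule jacobian_ham[where F = "\<lambda>z. force2 (z $ 1) (z $ 2)", OF reg that])
      (rule hamiltonian_field_ham)
  show "J $ 4 $ 3 = 0" "J $ 4 $ 4 = 0"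
    by (rule J4, unfold nth_add_axis, rule DERIV_const)+
  show "J $ 3 $ 1 = 2 * a\<^sup>2 * m\<^sup>2 * P\<^sup>2 / ((exp w1)\<^sup>2 * N ^ 3) - a * m * (m - 1) * P / ((exp w1)\<^sup>2 * N\<^sup>2)"
    by (rule J3, unfold nth_add_axis z, rule D31)
  show "J $ 3 $ 2 = 2 * a * b * m\<^sup>2 * P * (Q / exp w2) / (exp w1 * N ^ 3)"
    by (rule J3, unfold nth_add_axis z, rule D32)
  show "J $ 4 $ 1 = 2 * a * b * m\<^sup>2 * P * (Q / exp w2) / (exp w1 * N ^ 3)"
    by (rule J4, unfold nth_add_axis z, rule D41)
  show "J $ 4 $ 2 = 2 * b\<^sup>2 * m\<^sup>2 * (Q / exp w2)\<^sup>2 / N ^ 3 - b * m * (m - 1) * (Q / (exp w2)\<^sup>2) / N\<^sup>2"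
    by (rule J4, unfold nth_add_axis z, rule D42)
qed

end

section \<open>Limits at a point of the invariant plane\<close>

lemma tendsto_pot_denom:
  assumes "m > 0"
  shows "((\<lambda>w. a * P + b * exp (complex_of_real m * w)) \<longlongrightarrow> a * P) q2_to_0"
proof -
  have "((\<lambda>w. a * P + b * exp (complex_of_real m * w)) \<longlongrightarrow> a * P + b * 0) q2_to_0"
    by (intro tendsto_intros tendsto_exp_mult_q2_to_0 assms)
  then show ?thesis by simp
qed

lemma exp_mult_div_exp:
  "exp (complex_of_real m * w) / exp w = exp (complex_of_real (m - 1) * w)"
  "exp (complex_of_real m * w) / (exp w)\<^sup>2 = exp (complex_of_real (m - 2) * w)"
proof -
  have "complex_of_real m * w - w = complex_of_real (m - 1) * w"
    "complex_of_real m * w - (w + w) = complex_of_real (m - 2) * w"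
    by (simp_all add: algebra_simps)
  then show "exp (complex_of_real m * w) / exp w = exp (complex_of_real (m - 1) * w)"
    "exp (complex_of_real m * w) / (exp w)\<^sup>2 = exp (complex_of_real (m - 2) * w)"
    unfolding power2_eq_square exp_add[symmetric] exp_diff[symmetric] by simp_all
qed

context
  fixes m :: real and a b l :: complex and z :: "complex^4" and P :: complex
  assumes m: "m > 2" and a: "a \<noteq> 0"
    and z: "exp l = z $ 1" "z $ 2 = 0" "z $ 4 = 0"
  defines "P \<equiv> exp (of_real m * l)"
begin

lemma P_nz [simp]: "P \<noteq> 0"
  by (simp add: P_def)

lemma q_nz [simp]: "z $ 1 \<noteq> 0"
  using z(1) by (metis exp_not_eq_zero)

lemma power_branch_at: "power_branch m l (z $ 1) = P"
  unfolding P_def z(1)[symmetric] by simp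

lemma pot_denom_at: "pot_denom m a b l w (exp l) (exp w) = a * P + b * exp (of_real m * w)"
  by (simp add: pot_denom_def P_def)

lemma eventually_pot_denom_nz: "\<forall>\<^sub>F w in q2_to_0. pot_denom m a b l w (exp l) (exp w) \<noteq> 0"
  unfolding pot_denom_at using m a
  by (intro tendsto_imp_eventually_ne[OF tendsto_pot_denom]) auto

lemma regular_point_at:
  "pot_denom m a b l w (exp l) (exp w) \<noteq> 0 \<Longrightarrow> regular_point m a b l w (z + axis 2 (exp w))"
  unfolding regular_point_def nth_add_axis z(2) z(1)[symmetric] by simp

lemma tendsto_ham_q2_to_0:
  "((\<lambda>w. ham m a b l w (z + axis 2 (exp w))) \<longlongrightarrow> (z $ 3)\<^sup>2 / 2 - 1 / (a * P)) q2_to_0"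
proof -
  have "((\<lambda>w. (z $ 3)\<^sup>2 / 2 - 1 / (a * P + b * exp (of_real m * w)))
      \<longlongrightarrow> (z $ 3)\<^sup>2 / 2 - 1 / (a * P)) q2_to_0"
    using m a by (intro tendsto_intros tendsto_pot_denom) auto
  moreover have "ham m a b l w (z + axis 2 (exp w)) = (z $ 3)\<^sup>2 / 2 - 1 / (a * P + b * exp (of_real m * w))" for w
    by (simp only: ham_def nth_add_axis z(1)[symmetric]) (simp add: z power_branch_at)
  ultimately show ?thesis by simp
qed

lemma tendsto_hamiltonian_field_q2_to_0:
  defines "X \<equiv> \<lambda>w. hamiltonian_field (ham m a b l w) (z + axis 2 (exp w))"
  shows "((\<lambda>w. X w $ 1) \<longlongrightarrow> z $ 3) q2_to_0"
    and "((\<lambda>w. X w $ 3) \<longlongrightarrow> - (m / (a * z $ 1 * P))) q2_to_0"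
proof -
  show "((\<lambda>w. X w $ 1) \<longlongrightarrow> z $ 3) q2_to_0"
    unfolding X_def hamiltonian_field_ham nth_add_axis by (rule tendsto_const)
  have "\<forall>\<^sub>F w in q2_to_0. X w $ 3 = - (a * m * P / (z $ 1 * (a * P + b * exp (of_real m * w))\<^sup>2))"
    using eventually_pot_denom_nz
  proof eventually_elim
    case (elim w)
    from hamiltonian_field_ham(3)[OF regular_point_at[OF elim]] show ?case
      unfolding X_def
      by (simp add: axis_def force1_def pot_denom_def z power_branch_at)
  qed
  moreover have "((\<lambda>w. - (a * m * P / (z $ 1 * (a * P + b * exp (of_real m * w))\<^sup>2)))
      \<longlongrightarrow> - (a * m * P / (z $ 1 * (a * P)\<^sup>2))) q2_to_0"
    using m a by (intro tendsto_intros tendsto_pot_denom) auto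
  ultimately have "((\<lambda>w. X w $ 3) \<longlongrightarrow> - (a * m * P / (z $ 1 * (a * P)\<^sup>2))) q2_to_0"
    by (simp add: tendsto_cong)
  moreover have "a * m * P / (z $ 1 * (a * P)\<^sup>2) = m / (a * z $ 1 * P)"
    using a by (simp add: field_simps power2_eq_square)
  ultimately show "((\<lambda>w. X w $ 3) \<longlongrightarrow> - (m / (a * z $ 1 * P))) q2_to_0"
    by (simp only:)
qed

definition limit_jacobian :: "complex^4^4" where
  "limit_jacobian = vector
    [vector [0, 0, 1, 0],
     vector [0, 0, 0, 1],
     vector [m * (m + 1) / (a * P * (z $ 1)\<^sup>2), 0, 0, 0],
     vector [0, 0, 0, 0]]"

lemma tendsto_jacobian_q2_to_0:
  "((\<lambda>w. jacobian (hamiltonian_field (ham m a b l w)) (z + axis 2 (exp w))) \<longlongrightarrow> limit_jacobian) q2_to_0"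
proof -
  define J where "J w = jacobian (hamiltonian_field (ham m a b l w)) (z + axis 2 (exp w))" for w
  define Q where "Q w = exp (complex_of_real m * w)" for w
  have "(z + axis 2 (exp w)) $ 1 = exp l" "(z + axis 2 (exp w)) $ 2 = exp w" for w
    unfolding nth_add_axis using z by simp_all
  note entries = jacobian_ham_entries[OF this, where m = m and a = a and b = b, folded J_def P_def, folded Q_def]
  have nz: "\<forall>\<^sub>F w in q2_to_0. pot_denom m a b l w (exp l) (exp w) \<noteq> 0"
    by (rule eventually_pot_denom_nz)
  have N: "((\<lambda>w. a * P + b * Q w) \<longlongrightarrow> a * P) q2_to_0"
    unfolding Q_def using m by (intro tendsto_pot_denom) simp
  \<comment> \<open>The hypothesis m > 2 enters here: the exponents m - 1 and m - 2 are
    positive.\<close>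
  have Q1: "((\<lambda>w. Q w / exp w) \<longlongrightarrow> 0) q2_to_0" and Q2: "((\<lambda>w. Q w / (exp w)\<^sup>2) \<longlongrightarrow> 0) q2_to_0"
    unfolding Q_def exp_mult_div_exp using m by (simp_all add: tendsto_exp_mult_q2_to_0 del: of_real_diff)
  have aP: "a * P \<noteq> 0" using a by simp
  have eq: "((\<lambda>w. J w $ i $ j) \<longlongrightarrow> c) q2_to_0"
    if "\<And>w. pot_denom m a b l w (exp l) (exp w) \<noteq> 0 \<Longrightarrow> J w $ i $ j = f w" "(f \<longlongrightarrow> c) q2_to_0" for i j f c
  proof -
    have "\<forall>\<^sub>F w in q2_to_0. J w $ i $ j = f w"
      using nz by eventually_elim (rule that(1))
    then show ?thesis using that(2) by (simp add: tendsto_cong)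
  qed
  have J31: "((\<lambda>w. J w $ 3 $ 1) \<longlongrightarrow> 2 * a\<^sup>2 * m\<^sup>2 * P\<^sup>2 / ((exp l)\<^sup>2 * (a * P) ^ 3)
      - a * m * (m - 1) * P / ((exp l)\<^sup>2 * (a * P)\<^sup>2)) q2_to_0"
    by (rule eq[OF entries(13)], assumption) (intro tendsto_intros N; use aP in simp)
  \<comment> \<open>Over the common denominator a P q1^2 the numerators combine as 2 m^2 - m (m - 1)
    = m (m + 1).\<close>
  have J31_eq: "2 * a\<^sup>2 * m\<^sup>2 * P\<^sup>2 / ((exp l)\<^sup>2 * (a * P) ^ 3)
      - a * m * (m - 1) * P / ((exp l)\<^sup>2 * (a * P)\<^sup>2) = m * (m + 1) / (a * P * (z $ 1)\<^sup>2)"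
    using a by (simp add: z(1) field_simps power2_eq_square power3_eq_cube)
  have J32: "((\<lambda>w. J w $ 3 $ 2) \<longlongrightarrow> 2 * a * b * m\<^sup>2 * P * 0 / (exp l * (a * P) ^ 3)) q2_to_0"
    by (rule eq[OF entries(14)], assumption) (intro tendsto_intros N Q1; use aP in simp)
  have J41: "((\<lambda>w. J w $ 4 $ 1) \<longlongrightarrow> 2 * a * b * m\<^sup>2 * P * 0 / (exp l * (a * P) ^ 3)) q2_to_0"
    by (rule eq[OF entries(15)], assumption) (intro tendsto_intros N Q1; use aP in simp)
  have J42: "((\<lambda>w. J w $ 4 $ 2) \<longlongrightarrow> 2 * b\<^sup>2 * m\<^sup>2 * 0\<^sup>2 / (a * P) ^ 3 - b * m * (m - 1) * 0 / (a * P)\<^sup>2) q2_to_0"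
    by (rule eq[OF entries(16)], assumption) (intro tendsto_intros N Q1 Q2; use aP in simp)
  have const: "((\<lambda>w. J w $ i $ j) \<longlongrightarrow> c) q2_to_0"
    if "\<And>w. pot_denom m a b l w (exp l) (exp w) \<noteq> 0 \<Longrightarrow> J w $ i $ j = c" for i j c
    by (rule eq[OF that], assumption) (rule tendsto_const)
  have "\<forall>i j. ((\<lambda>w. J w $ i $ j) \<longlongrightarrow> limit_jacobian $ i $ j) q2_to_0"
    unfolding forall_4 limit_jacobian_def vector_4
    using J31[unfolded J31_eq] J32 J41 J42 entries(1-12)[THEN const] by simp
  then show ?thesis
    unfolding J_def[symmetric] by (intro vec_tendstoI) simp
qed

end

text \<open>Zero energy gives p1' = - m p1^2 / (2 q1), so (q1 / p1)' = 1 - q1 p1' / p1^2 = 1 + m /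
  2. It also turns 1 / (a q1^m q1^2) into half the inverse square of q1 / p1, so the coefficient is
  found without solving for q1.\<close>

lemma zero_energy_curve_time:
  assumes m: "m > 2" and a: "a \<noteq> 0" and curve: "zero_energy_curve m a b U \<gamma> lg"
  obtains t0 where "\<And>t. t \<in> U \<Longrightarrow> t \<noteq> t0"
    and "\<And>t. t \<in> U \<Longrightarrow> of_real (m * (m + 1)) / (a * exp (of_real m * lg t) * (\<gamma> t $ 1)\<^sup>2)
           = of_real (2 * m * (m + 1) / (m + 2)\<^sup>2) / (t - t0)\<^sup>2"
proof -
  have U: "open U" "connected U" using curve by (simp_all add: zero_energy_curve_def)
  have z: "exp (lg t) = \<gamma> t $ 1" "\<gamma> t $ 2 = 0" "\<gamma> t $ 4 = 0" if "t \<in> U" for t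
    using curve that by (simp_all add: zero_energy_curve_def)
  have energy: "1 / (a * exp (of_real m * lg t)) = (\<gamma> t $ 3)\<^sup>2 / 2" if t: "t \<in> U" for t
  proof -
    have "((\<lambda>w. ham m a b (lg t) w (\<gamma> t + axis 2 (exp w))) \<longlongrightarrow> 0) q2_to_0"
      using curve t by (simp add: zero_energy_curve_def)
    from tendsto_unique[OF q2_to_0_neq_bot this tendsto_ham_q2_to_0[OF m a z[OF t]]]
    show ?thesis by simp
  qed
  have p_nz: "\<gamma> t $ 3 \<noteq> 0" if "t \<in> U" for t
    using energy[OF that] a by auto
  have q_nz: "\<gamma> t $ 1 \<noteq> 0" if "t \<in> U" for t
    using z(1)[OF that] by (metis exp_not_eq_zero)
  define c where "c = complex_of_real (1 + m / 2)"
  have c: "c \<noteq> 0" using m by (simp add: c_def flip: of_real_add of_real_divide)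
  have "((\<lambda>t. \<gamma> t $ 1 / \<gamma> t $ 3 - c * t) has_field_derivative 0) (at t)" if t: "t \<in> U" for t
  proof -
    obtain v where v: "\<And>i. ((\<lambda>s. \<gamma> s $ i) has_field_derivative v $ i) (at t)"
      and lim: "((\<lambda>w. hamiltonian_field (ham m a b (lg t) w) (\<gamma> t + axis 2 (exp w))) \<longlongrightarrow> v) q2_to_0"
      using curve t unfolding zero_energy_curve_def by blast
    have v1: "v $ 1 = \<gamma> t $ 3"
      by (rule tendsto_unique[OF q2_to_0_neq_bot tendsto_vec_nth[OF lim]
            tendsto_hamiltonian_field_q2_to_0(1)[OF m a z[OF t]]])
    have "v $ 3 = - (m / (a * \<gamma> t $ 1 * exp (of_real m * lg t)))"
      by (rule tendsto_unique[OF q2_to_0_neq_bot tendsto_vec_nth[OF lim]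
            tendsto_hamiltonian_field_q2_to_0(2)[OF m a z[OF t]]])
    also have "\<dots> = - (m / \<gamma> t $ 1 * (1 / (a * exp (of_real m * lg t))))" by simp
    finally have v3: "v $ 3 = - (m / \<gamma> t $ 1 * ((\<gamma> t $ 3)\<^sup>2 / 2))"
      unfolding energy[OF t] .
    show ?thesis
      using p_nz[OF t] q_nz[OF t]
      by (auto intro!: derivative_eq_intros v simp: v1 v3 c_def field_simps power2_eq_square)
  qed
  then have "(\<lambda>t. \<gamma> t $ 1 / \<gamma> t $ 3 - c * t) constant_on U"
    using U(2,1) by (rule has_field_derivative_0_imp_constant_on)
  then obtain d where d: "\<gamma> t $ 1 / \<gamma> t $ 3 - c * t = d" if "t \<in> U" for t
    unfolding constant_on_def by blast
  \<comment> \<open>The zero of the affine function q1 / p1. It lies outside U because q1 and p1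
    have no zeros there.\<close>
  define t0 where "t0 = - d / c"
  have g: "\<gamma> t $ 1 / \<gamma> t $ 3 = c * (t - t0)" if "t \<in> U" for t
    using d[OF that] c by (simp add: t0_def field_simps)
  have ne: "t \<noteq> t0" if "t \<in> U" for t
    using g[OF that] p_nz[OF that] q_nz[OF that] by auto
  moreover have "of_real (m * (m + 1)) / (a * exp (of_real m * lg t) * (\<gamma> t $ 1)\<^sup>2)
           = of_real (2 * m * (m + 1) / (m + 2)\<^sup>2) / (t - t0)\<^sup>2" if t: "t \<in> U" for t
  proof -
    have "of_real (m * (m + 1)) / (a * exp (of_real m * lg t) * (\<gamma> t $ 1)\<^sup>2)
        = of_real (m * (m + 1)) / (\<gamma> t $ 1)\<^sup>2 * (1 / (a * exp (of_real m * lg t)))" by simp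
    also have "\<dots> = of_real (m * (m + 1)) / 2 / (\<gamma> t $ 1 / \<gamma> t $ 3)\<^sup>2"
      unfolding energy[OF t] using p_nz[OF t] q_nz[OF t] by (simp add: field_simps)
    also have "\<dots> = of_real (m * (m + 1)) / 2 / (c\<^sup>2 * (t - t0)\<^sup>2)"
      unfolding g[OF t] by (simp add: power_mult_distrib)
    also have "\<dots> = of_real (m * (m + 1) / 2 / (1 + m / 2)\<^sup>2) / (t - t0)\<^sup>2"
      by (simp add: c_def)
    also have "m * (m + 1) / 2 / (1 + m / 2)\<^sup>2 = 2 * m * (m + 1) / (m + 2)\<^sup>2"
      using m by (simp add: divide_simps power2_eq_square) (simp add: algebra_simps)
    finally show ?thesis .
  qed
  ultimately show ?thesis using that by blast
qed

text \<open>After clearing denominators, the difference of f and g is governed by a polynomial with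
  infinitely many roots.\<close>

lemma ratfun_value_unique:
  assumes "infinite S" and val: "\<And>t. t \<in> S \<Longrightarrow> \<exists>v. ratfun_value f t v \<and> ratfun_value g t v"
  shows "f = g"
proof -
  obtain p q where f: "f = Fract p q" "q \<noteq> 0" by (cases f) auto
  obtain r s where g: "g = Fract r s" "s \<noteq> 0" by (cases g) auto
  \<comment> \<open>The value may come from another representation of the fraction. The form without
    division remains valid even where the chosen denominator q vanishes.\<close>
  have eval_eq: "v * poly q t = poly p t" if rv: "ratfun_value (Fract p q) t v" and q: "q \<noteq> 0" for p q t v
  proof -
    obtain p' q' where *: "Fract p q = Fract p' q'" "poly q' t \<noteq> 0" "v = poly p' t / poly q' t"
      using rv unfolding ratfun_value_def by blast
    then have "q' \<noteq> 0" by auto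
    then have "p * q' = p' * q" using * q by (simp add: eq_fract)
    then have "poly p t * poly q' t = poly p' t * poly q t" by (metis poly_mult)
    then have "v * poly q t * poly q' t = poly p t * poly q' t" using * by simp
    then show ?thesis using * by simp
  qed
  have "poly (p * s - r * q) t = 0" if t: "t \<in> S" for t
  proof -
    obtain v where v: "ratfun_value f t v" "ratfun_value g t v" using val[OF t] by blast
    have eqs: "v * poly q t = poly p t" "v * poly s t = poly r t"
      using eval_eq v f g by simp_all
    show ?thesis by (simp add: ac_simps flip: eqs)
  qed
  then have "S \<subseteq> {t. poly (p * s - r * q) t = 0}" by blast
  then have "p * s - r * q = 0"
    using assms(1) poly_roots_finite finite_subset by blast
  then show ?thesis using f g by (simp add: eq_fract)
qed

text \<open>Gives existence and uniqueness together: the limit of the Jacobian determines the values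
  of A on U, and the infinite set U determines its rational entries.\<close>

lemma variational_matrix_zero_energy_curve:
  assumes m: "m > 2" and a: "a \<noteq> 0" and curve: "zero_energy_curve m a b U \<gamma> lg"
  shows "\<exists>t0. \<forall>A. variational_matrix m a b U \<gamma> lg A \<longleftrightarrow>
    A = var_matrix (of_real (2 * (m + 1) / (m + 2))) t0"
proof -
  define r where "r = complex_of_real (2 * (m + 1) / (m + 2))"
  obtain t0 where t0: "\<And>t. t \<in> U \<Longrightarrow> t \<noteq> t0"
    and coeff: "\<And>t. t \<in> U \<Longrightarrow> of_real (m * (m + 1)) / (a * exp (of_real m * lg t) * (\<gamma> t $ 1)\<^sup>2)
           = of_real (2 * m * (m + 1) / (m + 2)\<^sup>2) / (t - t0)\<^sup>2"
    using zero_energy_curve_time[OF m a curve] by blast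
  have z: "exp (lg t) = \<gamma> t $ 1" "\<gamma> t $ 2 = 0" "\<gamma> t $ 4 = 0" if "t \<in> U" for t
    using curve that by (simp_all add: zero_energy_curve_def)
  \<comment> \<open>Origin of r: since r - 1 = m / (m + 2), r is a root of the indicial equation of
    the Euler equation.\<close>
  have "2 * (m + 1) / (m + 2) * (2 * (m + 1) / (m + 2) - 1) = 2 * m * (m + 1) / (m + 2)\<^sup>2"
    using m by (simp add: field_simps power2_eq_square)
  then have rr: "r * (r - 1) = of_real (2 * m * (m + 1) / (m + 2)\<^sup>2)"
    unfolding r_def by (metis of_real_1 of_real_diff of_real_mult)
  define J where "J t = limit_jacobian m a (lg t) (\<gamma> t)" for t
  have lim: "((\<lambda>w. jacobian (hamiltonian_field (ham m a b (lg t) w)) (\<gamma> t + axis 2 (exp w)))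
      \<longlongrightarrow> J t) q2_to_0" if "t \<in> U" for t
    unfolding J_def by (rule tendsto_jacobian_q2_to_0[OF m a z[OF that]])
  have J: "ratfun_value (var_matrix r t0 $ i $ j) t (J t $ i $ j)" if t: "t \<in> U" for t i j
  proof -
    have 0: "ratfun_value 0 t 0"
      unfolding ratfun_value_def by (rule exI[of _ 0], rule exI[of _ 1]) (simp add: Zero_fract_def)
    have 1: "ratfun_value 1 t 1"
      unfolding ratfun_value_def by (rule exI[of _ 1], rule exI[of _ 1]) (simp add: One_fract_def)
    have "to_fract [:r * (r - 1):] / to_fract [:-t0, 1:] ^ 2
        = Fract [:r * (r - 1):] ([:-t0, 1:] ^ 2)"
      by (simp add: to_fract_def power2_eq_square)
    moreover have "poly ([:-t0, 1:] ^ 2) t \<noteq> 0" using t0[OF t] by simp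
    moreover have "of_real (m * (m + 1)) / (a * exp (of_real m * lg t) * (\<gamma> t $ 1)\<^sup>2)
        = poly [:r * (r - 1):] t / poly ([:-t0, 1:] ^ 2) t"
      unfolding coeff[OF t] rr by simp
    ultimately have "ratfun_value (to_fract [:r * (r - 1):] / to_fract [:-t0, 1:] ^ 2) t
        (of_real (m * (m + 1)) / (a * exp (of_real m * lg t) * (\<gamma> t $ 1)\<^sup>2))"
      unfolding ratfun_value_def by blast
    then have "\<forall>i j. ratfun_value (var_matrix r t0 $ i $ j) t (J t $ i $ j)"
      unfolding forall_4 var_matrix_def J_def limit_jacobian_def[OF m a z[OF t]] vector_4
      using 0 1 by simp
    then show ?thesis by blast
  qed
  have "infinite U"
    using curve finite_imp_not_open by (auto simp: zero_energy_curve_def)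
  have "variational_matrix m a b U \<gamma> lg A \<longleftrightarrow> A = var_matrix r t0" for A
  proof
    assume A: "variational_matrix m a b U \<gamma> lg A"
    have "ratfun_value (A $ i $ j) t (J t $ i $ j)" if t: "t \<in> U" for t i j
    proof -
      obtain M where M: "((\<lambda>w. jacobian (hamiltonian_field (ham m a b (lg t) w)) (\<gamma> t + axis 2 (exp w)))
          \<longlongrightarrow> M) q2_to_0" "ratfun_value (A $ i $ j) t (M $ i $ j)"
        using A t unfolding variational_matrix_def by blast
      have "M = J t" by (rule tendsto_unique[OF q2_to_0_neq_bot M(1) lim[OF t]])
      then show ?thesis using M by simp
    qed
    then have "A $ i $ j = var_matrix r t0 $ i $ j" for i j
      using ratfun_value_unique[OF \<open>infinite U\<close>, of "A $ i $ j" "var_matrix r t0 $ i $ j"] J by blast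
    then show "A = var_matrix r t0" by (simp add: vec_eq_iff)
  next
    assume "A = var_matrix r t0"
    then show "variational_matrix m a b U \<gamma> lg A"
      unfolding variational_matrix_def using lim J by blast
  qed
  then show ?thesis unfolding r_def by blast
qed

lemma galois_group_zero_energy_curve:
  assumes "m > 2" "a \<noteq> 0" "zero_energy_curve m a b U \<gamma> lg"
    and A: "variational_matrix m a b U \<gamma> lg A" and G: "diff_galois_group \<iota> D A G"
  shows "conjugate_in_GL G (diag_matrix ` power_multipliers (of_real (2 * (m + 1) / (m + 2))))"
proof -
  define r where "r = complex_of_real (2 * (m + 1) / (m + 2))"
  obtain t0 where "A = var_matrix r t0"
    using variational_matrix_zero_energy_curve[OF assms(1-3)] A unfolding r_def by auto
  \<comment> \<open>Equality would mean 4 (m + 1) = m + 2, that is m = -2/3.\<close>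
  moreover have "2 * r \<noteq> 1"
  proof
    assume "2 * r = 1"
    then have "complex_of_real (2 * (2 * (m + 1) / (m + 2))) = of_real 1" by (simp add: r_def)
    then have "2 * (2 * (m + 1) / (m + 2)) = 1" by (simp only: of_real_eq_iff)
    then show False using assms(1) by (simp add: field_simps)
  qed
  ultimately show ?thesis
    using diff_galois_group_var_matrix[of \<iota> D r t0 G] G unfolding r_def by simp
qed

text \<open>Two field types appear so that Galois groups taken in unrelated Picard-Vessiot
  extensions can be compared. Uniqueness and existence of A make the variational equation over C(t)
  a well-defined object.\<close>

theorem mainTheorem1:
  fixes m :: real
    and \<iota> :: "ratfun \<Rightarrow> 'k::field" and D :: "'k \<Rightarrow> 'k"
    and \<iota>' :: "ratfun \<Rightarrow> 'l::field" and D' :: "'l \<Rightarrow> 'l"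
  assumes "m > 2"
  shows
    "(\<forall>a b U \<gamma> lg. a \<noteq> 0 \<and> zero_energy_curve m a b U \<gamma> lg \<longrightarrow>
        (\<exists>!A. variational_matrix m a b U \<gamma> lg A) \<and>
        (\<forall>A G. variational_matrix m a b U \<gamma> lg A \<and> diff_galois_group \<iota> D A G \<longrightarrow>
           virtually_abelian G)) \<and>
     (\<forall>a b U \<gamma> lg A G a' b' U' \<gamma>' lg' A' G'.
        a \<noteq> 0 \<and> zero_energy_curve m a b U \<gamma> lg \<and>
        variational_matrix m a b U \<gamma> lg A \<and> diff_galois_group \<iota> D A G \<and>
        a' \<noteq> 0 \<and> zero_energy_curve m a' b' U' \<gamma>' lg' \<and>
        variational_matrix m a' b' U' \<gamma>' lg' A' \<and> diff_galois_group \<iota>' D' A' G' \<longrightarrow>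
        conjugate_in_GL G G')"
proof -
  note group = galois_group_zero_energy_curve[OF assms]
  show ?thesis
  proof (intro conjI allI impI; elim conjE)
    fix a b U \<gamma> lg
    assume "a \<noteq> 0" "zero_energy_curve m a b U \<gamma> lg"
    from variational_matrix_zero_energy_curve[OF assms this]
    show "\<exists>!A. variational_matrix m a b U \<gamma> lg A" by auto
  next
    fix a b U \<gamma> lg A G
    assume "a \<noteq> 0" "zero_energy_curve m a b U \<gamma> lg"
      "variational_matrix m a b U \<gamma> lg A" "diff_galois_group \<iota> D A G"
    from conjugate_in_GL_sym[OF group[OF this]] show "virtually_abelian G"
      by (rule virtually_abelian_if_conjugate_to_commutative) (auto simp: diag_matrix_commute)
  next
    fix a b U \<gamma> lg A G a' b' U' \<gamma>' lg' A' G'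
    assume "a \<noteq> 0" "zero_energy_curve m a b U \<gamma> lg"
      "variational_matrix m a b U \<gamma> lg A" "diff_galois_group \<iota> D A G"
    note G = group[OF this]
    assume "a' \<noteq> 0" "zero_energy_curve m a' b' U' \<gamma>' lg'"
      "variational_matrix m a' b' U' \<gamma>' lg' A'" "diff_galois_group \<iota>' D' A' G'"
    from conjugate_in_GL_trans[OF G conjugate_in_GL_sym[OF group[OF this]]]
    show "conjugate_in_GL G G'" .
  qed
qed

end
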